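(* For $\mathbf P$-almost every realization of $\mathcal T_\infty^{\mathrm{dec}}$, the simple random walk $(X_n)_{n\ge0}$ on $\mathcal T_\infty^{\mathrm{dec}}$ started at $\rho^{\mathrm{dec}}$ is recurrent.
   Context: Offspring law. Fix $\alpha\in(1,2)$ and a critical (mean $1$) probability distribution $\xi$ on $\{0,1,2,\dots\}$ with $\xi(k)\sim ck^{-\alpha-1}$ as $k\to\infty$ for some $c\in(0,\infty)$. Kesten's tree $T_\infty$ (a plane tree with root $\rho$): individuals are normal or special; the root is special; a normal individual has a $\xi$-distributed number of children, all normal; a special individual has a number of children with law $\xi^*(n)=n\xi(n)$, one of which, chosen uniformly, is special and the others normal; all choices independent. The special vertices form the infinite backbone $\rho=s_0,s_1,\dots$. The children of $u$ are $u1,\dots,uk_u$ from left to right; $\mathrm{par}(u)$ is the parent of $u$. The tree is planted: an extra vertex $\mathrm{par}(\rho)$ is joined to $\rho$ by an edge, so $\deg u=k_u+1$ for every $u\in T_\infty\setminus\{\mathrm{par}(\rho)\}$. Inserted graphs. For each $n\ge1$ let $(G_n,d_n,V_n,\ell_n)$ have a given law, where $G_n$ is an a.s. connected (possibly random) graph with a set $\partial G_n$ of $n$ distinguished boundary vertices, $d_n$ is a metric on $G_n$, $V_n$ is the degree measure $V_n(x)=\deg x$ on $G_n$ and $\ell_n:\partial G_n\to\{0,\dots,n-1\}$ is a bijection. Decorated tree (on a probability space with law $\mathbf P$). Given $T_\infty$, sample independently for each $u\in T_\infty\setminus\{\mathrm{par}(\rho)\}$ a copy $(G(u),d(u),V(u),\ell(u))$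 of $(G_{\deg u},d_{\deg u},V_{\deg u},\ell_{\deg u})$ and an independent uniform $U_u\in\{0,\dots,\deg u-1\}$. Associate to the boundary vertex $x\in\partial G(u)$, with $j=(\ell(u)(x)+U_u)\bmod \deg u$, the tree edge $(u,\mathrm{par}(u))$ if $j=0$ and $(u,uj)$ otherwise. $\mathcal T_\infty^{\mathrm{dec}}$ is the graph obtained from the disjoint union of the $G(u)$ by identifying boundary vertices associated with the same tree edge. Finally a new vertex $\rho^{\mathrm{dec}}$, the root, is joined by one edge to the boundary vertex of $G(\rho)$ associated with $(\rho,\mathrm{par}(\rho))$. Assumption. Let $(U^{(1)}_n,U^{(2)}_n)$ be a uniform pair of distinct vertices of $\partial G_n$; $d_n^U=d_n(U^{(1)}_n,U^{(2)}_n)$, $R_n^U=R_{\mathrm{eff}}(U_n^{(1)},U_n^{(2)})$ (effective resistance in $G_n$ with unit conductances), $\mathrm{Diam}(G_n)=\sup_{x,y}d_n(x,y)$, $\mathrm{Diam}_{\mathrm{res}}(G_n)=\sup_{x,y}R_{\mathrm{eff}}(x,y)$. There exist $d,R,v\ge1$ and $\epsilon>0$ with: (D) $\inf_{n\ge2}\mathbf P(d_n^U\ge n^{1/d})>0$ and $\sup_{n\ge1}\mathbf P(\mathrm{Diam}(G_n)\ge\lambda n^{1/d})=O(\lambda^{-\frac{\alpha+\epsilon}{\alpha-1}})$ as $\lambda\to\infty$; (R) $\inf_{n\ge2}\mathbf P(R_n^U\ge n^{1/R})>0$ and $\sup_{n\ge1}\mathbf P(\mathrm{Diam}_{\mathrm{res}}(G_n)\ge\lambda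 n^{1/R})=O(\lambda^{-\frac{\alpha+\epsilon}{\alpha-1}})$; (V) $\inf_{n\ge1}\mathbf P(V_n(G_n)\ge n^{v})>0$ and $\sup_{n\ge1}\mathbf P(V_n(G_n)\ge\lambda n^{v})=O(\lambda^{-\frac{\alpha+\epsilon}{v}})$. The simple random walk moves at each step along a uniformly chosen incident edge. *)

theory Defs
  imports "HOL-Probability.Probability" "HOL-Library.Landau_Symbols"
begin

subsection \<open>Graphs\<close>

text \<open>
  Undirected multigraphs: \<open>mult G x y\<close> is the number of edges joining \<open>x\<close> and \<open>y\<close>.
  Simple graphs are the case of multiplicities in \<open>{0, 1}\<close> with \<open>mult G x x = 0\<close>. The number
  \<open>mult G x x\<close> is the contribution of the loops at \<open>x\<close> to the degree of \<open>x\<close>, so that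
  either convention (a loop counts once or twice) is covered.
\<close>

record 'v mgraph =
  verts :: "'v set"
  mult :: "'v \<Rightarrow> 'v \<Rightarrow> nat"

definition wf_mgraph :: "('v, 'z) mgraph_scheme \<Rightarrow> bool" where
  "wf_mgraph G \<longleftrightarrow>
     (\<forall>x y. mult G x y = mult G y x) \<and>
     (\<forall>x y. mult G x y > 0 \<longrightarrow> x \<in> verts G \<and> y \<in> verts G)"

definition connected_mgraph :: "('v, 'z) mgraph_scheme \<Rightarrow> bool" where
  "connected_mgraph G \<longleftrightarrow> (\<forall>x\<in>verts G. \<forall>y\<in>verts G. (x, y) \<in> {(a, b). mult G a b > 0}\<^sup>*)"

definition degree :: "('v, 'z) mgraph_scheme \<Rightarrow> 'v \<Rightarrow> ennreal" where
  "degree G x = (\<integral>\<^sup>+y. of_nat (mult G x y) \<partial>count_space UNIV)"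

definition degree_measure :: "('v, 'z) mgraph_scheme \<Rightarrow> 'v measure" where
  "degree_measure G = point_measure (verts G) (degree G)"

text \<open>Every edge has conductance 1, so \<open>mult G x y\<close> is the total conductance between
  \<open>x\<close> and \<open>y\<close>. The factor 2 is there because each edge occurs as \<open>(x, y)\<close> and as \<open>(y, x)\<close>.\<close>

definition dirichlet_energy :: "('v, 'z) mgraph_scheme \<Rightarrow> ('v \<Rightarrow> real) \<Rightarrow> ennreal" where
  "dirichlet_energy G f =
     (\<integral>\<^sup>+x. (\<integral>\<^sup>+y. ennreal (real (mult G x y) * (f x - f y)\<^sup>2) \<partial>count_space UNIV) \<partial>count_space UNIV) / 2"

text \<open>With the conventions of \<^typ>\<open>ennreal\<close>, this is 0 for \<open>x = y\<close> (infimum of the empty set)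
  and infinite if \<open>x\<close> and \<open>y\<close> are not connected.\<close>

definition eff_resistance :: "('v, 'z) mgraph_scheme \<Rightarrow> 'v \<Rightarrow> 'v \<Rightarrow> ennreal" where
  "eff_resistance G x y = inverse (INF f\<in>{f. f x = 1 \<and> f y = 0}. dirichlet_energy G f)"

definition res_diameter :: "('v, 'z) mgraph_scheme \<Rightarrow> ennreal" where
  "res_diameter G = (SUP x\<in>verts G. SUP y\<in>verts G. eff_resistance G x y)"

subsection \<open>Simple random walk and recurrence\<close>

text \<open>A step chooses uniformly one of the edges incident to \<open>x\<close>: the pair \<open>(y, i)\<close> stands for
  the \<open>i\<close>-th edge from \<open>x\<close> to \<open>y\<close>. This is meaningful if the degree of \<open>x\<close> is positive and finite.\<close>

definition srw_step :: "('v, 'z) mgraph_scheme \<Rightarrow> 'v \<Rightarrow> 'v pmf" where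
  "srw_step G x = map_pmf fst (pmf_of_set {(y, i). i < mult G x y})"

fun srw_kernel :: "('v, 'z) mgraph_scheme \<Rightarrow> 'v \<Rightarrow> nat \<Rightarrow> (nat \<Rightarrow> 'v) \<Rightarrow> 'v measure" where
  "srw_kernel G x0 0 X = measure_pmf (return_pmf x0)"
| "srw_kernel G x0 (Suc n) X = measure_pmf (srw_step G (X n))"

lemma Ionescu_Tulcea_srw: "Ionescu_Tulcea (srw_kernel G x0) (\<lambda>_. count_space UNIV)"
proof (unfold Ionescu_Tulcea_def, intro conjI allI impI)
  fix i
  show "srw_kernel G x0 i \<in> Pi\<^sub>M {0..<i} (\<lambda>_. count_space UNIV) \<rightarrow>\<^sub>M subprob_algebra (count_space UNIV)"
  proof (cases i)
    case 0
    have "srw_kernel G x0 0 = (\<lambda>X. measure_pmf (return_pmf x0))"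
      by (simp add: fun_eq_iff)
    then show ?thesis
      by (simp add: 0 measure_pmf_in_subprob_algebra)
  next
    case (Suc n)
    have "(\<lambda>X. X n) \<in> Pi\<^sub>M {0..<Suc n} (\<lambda>_. count_space UNIV) \<rightarrow>\<^sub>M count_space UNIV"
      by (rule measurable_component_singleton) simp
    then have "(\<lambda>X. measure_pmf (srw_step G (X n)))
        \<in> Pi\<^sub>M {0..<Suc n} (\<lambda>_. count_space UNIV) \<rightarrow>\<^sub>M subprob_algebra (count_space UNIV)"
      by (rule measurable_compose) (simp add: measure_pmf_in_subprob_algebra)
    moreover have "srw_kernel G x0 (Suc n) = (\<lambda>X. measure_pmf (srw_step G (X n)))"
      by (simp add: fun_eq_iff)
    ultimately show ?thesis
      by (simp add: Suc)
  qed
next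
  fix i X
  show "prob_space (srw_kernel G x0 i X)"
    by (cases i) (auto simp: measure_pmf.prob_space_axioms)
qed

text \<open>The law of the trajectory \<open>(X 0, X 1, \<dots>)\<close>: the Ionescu-Tulcea measure of the kernels above.\<close>

definition srw :: "('v, 'z) mgraph_scheme \<Rightarrow> 'v \<Rightarrow> (nat \<Rightarrow> 'v) measure" where
  "srw G x0 = projective_family.lim UNIV
     (Ionescu_Tulcea.CI (srw_kernel G x0) (\<lambda>_. count_space UNIV)) (\<lambda>_. count_space UNIV)"

lemma prob_space_srw: "prob_space (srw G x0)"
proof -
  interpret IT: Ionescu_Tulcea "srw_kernel G x0" "\<lambda>_. count_space UNIV"
    by (rule Ionescu_Tulcea_srw)
  show ?thesis
    unfolding srw_def
    by (rule prob_space_distrD[where M = IT.PF.lim and f = "\<lambda>x. restrict x {}"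
          and N = "PiM {} (\<lambda>_. count_space UNIV)"],
        simp add: measurable_cong_sets[OF IT.PF.sets_lim refl] measurable_restrict,
        subst IT.distr_lim, simp, rule IT.PF.prob_space_P, auto)
qed

definition recurrent :: "('v, 'z) mgraph_scheme \<Rightarrow> 'v \<Rightarrow> bool" where
  "recurrent G x0 \<longleftrightarrow> (AE X in srw G x0. \<exists>\<^sub>\<infinity>n. X n = x0)"

subsection \<open>Inserted graphs\<close>

record 'v dgraph = "'v mgraph" +
  bdry :: "'v set"
  gdist :: "'v \<Rightarrow> 'v \<Rightarrow> real"
  lab :: "'v \<Rightarrow> nat"

definition is_inserted_graph :: "nat \<Rightarrow> 'v dgraph \<Rightarrow> bool" where
  "is_inserted_graph n g \<longleftrightarrow>
     wf_mgraph g \<and> connected_mgraph g \<and>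
     bdry g \<subseteq> verts g \<and> finite (bdry g) \<and> card (bdry g) = n \<and>
     Metric_space (verts g) (gdist g) \<and>
     bij_betw (lab g) (bdry g) {0..<n}"

text \<open>Random graphs have their vertices in the natural numbers. The \<open>\<sigma>\<close>-algebra is generated by
  the coordinates; a law of \<open>(G, d, V, \<ell>)\<close> is a probability measure on it (\<open>V\<close> being a
  function of \<open>G\<close>).\<close>

definition dgraph_space :: "nat dgraph measure" where
  "dgraph_space = sigma UNIV
     ((\<Union>x. {{g. x \<in> verts g}}) \<union> (\<Union>x y k. {{g. mult g x y = k}}) \<union> (\<Union>x. {{g. x \<in> bdry g}}) \<union>
      (\<Union>x y r. {{g. gdist g x y \<le> r}}) \<union> (\<Union>x i. {{g. lab g x = i}}))"

definition inserted_graph_law :: "nat \<Rightarrow> nat dgraph measure \<Rightarrow> bool" where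
  "inserted_graph_law n L \<longleftrightarrow>
     prob_space L \<and> sets L = sets dgraph_space \<and> (AE g in L. is_inserted_graph n g)"

definition graph_diameter :: "'v dgraph \<Rightarrow> ennreal" where
  "graph_diameter g = (SUP x\<in>verts g. SUP y\<in>verts g. ennreal (gdist g x y))"

definition total_volume :: "'v dgraph \<Rightarrow> ennreal" where
  "total_volume g = emeasure (degree_measure g) (verts g)"

definition prob_graph :: "nat dgraph measure \<Rightarrow> (nat dgraph \<Rightarrow> bool) \<Rightarrow> real" where
  "prob_graph L Q = measure L {g \<in> space L. Q g}"

text \<open>The probability that \<open>Q g x y\<close> holds for \<open>g\<close> of law \<open>L\<close> and, given \<open>g\<close>, a uniform pair
  \<open>(x, y)\<close> of distinct boundary vertices of \<open>g\<close>.\<close>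

definition prob_pair :: "nat dgraph measure \<Rightarrow> (nat dgraph \<Rightarrow> nat \<Rightarrow> nat \<Rightarrow> bool) \<Rightarrow> real" where
  "prob_pair L Q =
     (\<integral>g. measure_pmf.prob (pmf_of_set {(x, y). x \<in> bdry g \<and> y \<in> bdry g \<and> x \<noteq> y})
            {(x, y). Q g x y} \<partial>L)"

subsection \<open>Kesten's tree\<close>

text \<open>The size-biased law \<open>\<xi>\<^sup>*\<close>; a probability mass function when \<open>\<xi>\<close> has mean 1.\<close>

definition size_biased :: "nat pmf \<Rightarrow> nat pmf" where
  "size_biased \<xi> = embed_pmf (\<lambda>n. real n * pmf \<xi> n)"

lemma pmf_size_biased:
  assumes "integrable (measure_pmf \<xi>) real" "measure_pmf.expectation \<xi> real = 1"
  shows "pmf (size_biased \<xi>) n = real n * pmf \<xi> n"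
  unfolding size_biased_def
proof (rule pmf_embed_pmf)
  have "(\<integral>\<^sup>+ x. ennreal (real x) \<partial>measure_pmf \<xi>) = 1"
    using assms by (subst nn_integral_eq_integral) auto
  then show "(\<integral>\<^sup>+ x. ennreal (real x * pmf \<xi> x) \<partial>count_space UNIV) = 1"
    by (simp add: nn_integral_measure_pmf ennreal_mult mult.commute)
qed simp

text \<open>
  Ulam-Harris coding: individuals are finite words, the root is \<open>[]\<close> and the \<open>j\<close>-th child of \<open>u\<close>
  is \<open>u @ [j]\<close>, with \<open>j \<ge> 1\<close>. Every word \<open>u\<close> carries an independent triple \<open>(a, b, c)\<close>: \<open>a\<close> is the
  number of children of \<open>u\<close> if it is normal, \<open>b\<close> the number of children if it is special, and
  in that case the \<open>c\<close>-th child is the special one.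
\<close>

type_synonym genealogy = "nat list \<Rightarrow> nat \<times> nat \<times> nat"

definition individual_pmf :: "nat pmf \<Rightarrow> (nat \<times> nat \<times> nat) pmf" where
  "individual_pmf \<xi> =
     pair_pmf \<xi> (bind_pmf (size_biased \<xi>) (\<lambda>b. map_pmf (\<lambda>c. (b, c)) (pmf_of_set {1..b})))"

definition kesten :: "nat pmf \<Rightarrow> genealogy measure" where
  "kesten \<xi> = (\<Pi>\<^sub>M u\<in>UNIV. measure_pmf (individual_pmf \<xi>))"

inductive_set special :: "genealogy \<Rightarrow> nat list set" for \<tau> where
  root: "[] \<in> special \<tau>"
| child: "u \<in> special \<tau> \<Longrightarrow> \<tau> u = (a, b, c) \<Longrightarrow> u @ [c] \<in> special \<tau>"

definition num_children :: "genealogy \<Rightarrow> nat list \<Rightarrow> nat" where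
  "num_children \<tau> u = (case \<tau> u of (a, b, c) \<Rightarrow> if u \<in> special \<tau> then b else a)"

text \<open>The vertices of \<open>T\<^sub>\<infinity>\<close> other than the extra vertex \<open>par(\<rho>)\<close>.\<close>

inductive_set tree :: "genealogy \<Rightarrow> nat list set" for \<tau> where
  root: "[] \<in> tree \<tau>"
| child: "u \<in> tree \<tau> \<Longrightarrow> 1 \<le> j \<Longrightarrow> j \<le> num_children \<tau> u \<Longrightarrow> u @ [j] \<in> tree \<tau>"

definition tree_degree :: "genealogy \<Rightarrow> nat list \<Rightarrow> nat" where
  "tree_degree \<tau> u = num_children \<tau> u + 1"

subsection \<open>The decorated tree\<close>

text \<open>
  For every word \<open>u\<close> and every \<open>n \<ge> 1\<close> there is an independent copy of the inserted graph with
  \<open>n\<close> boundary vertices, together with an independent uniform element of \<open>{0,\<dots>,n-1}\<close>; the vertex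
  \<open>u\<close> of the tree uses the copy with \<open>n = deg u\<close>. As this array is independent of the tree, given
  \<open>T\<^sub>\<infinity>\<close> the decorations used are independent with the required laws.
\<close>

type_synonym decorations = "nat list \<times> nat \<Rightarrow> nat dgraph \<times> nat"

definition decoration_law :: "(nat \<Rightarrow> nat dgraph measure) \<Rightarrow> decorations measure" where
  "decoration_law L =
     (\<Pi>\<^sub>M (u, n)\<in>UNIV \<times> {1..}. L n \<Otimes>\<^sub>M measure_pmf (pmf_of_set {0..<n}))"

definition decorated_tree_law ::
    "nat pmf \<Rightarrow> (nat \<Rightarrow> nat dgraph measure) \<Rightarrow> (genealogy \<times> decorations) measure" where
  "decorated_tree_law \<xi> L = kesten \<xi> \<Otimes>\<^sub>M decoration_law L"

definition inserted :: "genealogy \<Rightarrow> decorations \<Rightarrow> nat list \<Rightarrow> nat dgraph" where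
  "inserted \<tau> \<delta> u = fst (\<delta> (u, tree_degree \<tau> u))"

definition rotation :: "genealogy \<Rightarrow> decorations \<Rightarrow> nat list \<Rightarrow> nat" where
  "rotation \<tau> \<delta> u = snd (\<delta> (u, tree_degree \<tau> u))"

text \<open>The tree edge associated with the boundary vertex \<open>x\<close> of \<open>G(u)\<close>. A tree edge
  \<open>(v, par(v))\<close> is represented by its lower endpoint \<open>v\<close>.\<close>

definition assoc_edge :: "genealogy \<Rightarrow> decorations \<Rightarrow> nat list \<Rightarrow> nat \<Rightarrow> nat list" where
  "assoc_edge \<tau> \<delta> u x =
     (let j = (lab (inserted \<tau> \<delta> u) x + rotation \<tau> \<delta> u) mod tree_degree \<tau> u
      in if j = 0 then u else u @ [j])"

definition disjoint_union :: "'i set \<Rightarrow> ('i \<Rightarrow> ('v, 'z) mgraph_scheme) \<Rightarrow> ('i \<times> 'v) mgraph" where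
  "disjoint_union I G =
     \<lparr>verts = (SIGMA i:I. verts (G i)),
      mult = (\<lambda>(i, x) (i', y). if i = i' \<and> i \<in> I then mult (G i) x y else 0)\<rparr>"

text \<open>The quotient graph for an equivalence relation \<open>r\<close> on the vertices. All edges are
  kept. (In the application, identified vertices are never joined by an edge.)\<close>

definition identify :: "('v \<times> 'v) set \<Rightarrow> 'v mgraph \<Rightarrow> 'v set mgraph" where
  "identify r G =
     \<lparr>verts = verts G // r,
      mult = (\<lambda>A B. if A \<in> verts G // r \<and> B \<in> verts G // r
                     then (\<Sum>x\<in>A. \<Sum>y\<in>B. mult G x y) else 0)\<rparr>"

text \<open>Add a new vertex \<^const>\<open>None\<close>, joined by one edge to \<open>a\<close>.\<close>

definition attach_root :: "'v \<Rightarrow> 'v mgraph \<Rightarrow> 'v option mgraph" where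
  "attach_root a G =
     \<lparr>verts = insert None (Some ` verts G),
      mult = (\<lambda>x y. case (x, y) of
         (Some v, Some w) \<Rightarrow> mult G v w
       | (None, Some w) \<Rightarrow> if w = a then 1 else 0
       | (Some v, None) \<Rightarrow> if v = a then 1 else 0
       | (None, None) \<Rightarrow> 0)\<rparr>"

definition pieces :: "genealogy \<Rightarrow> decorations \<Rightarrow> (nat list \<times> nat) mgraph" where
  "pieces \<tau> \<delta> = disjoint_union (tree \<tau>) (inserted \<tau> \<delta>)"

definition same_edge ::
    "genealogy \<Rightarrow> decorations \<Rightarrow> ((nat list \<times> nat) \<times> (nat list \<times> nat)) set" where
  "same_edge \<tau> \<delta> =
     {((u, x), (w, y)). (u, x) \<in> verts (pieces \<tau> \<delta>) \<and> (w, y) \<in> verts (pieces \<tau> \<delta>) \<and>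
        ((u, x) = (w, y) \<or>
         x \<in> bdry (inserted \<tau> \<delta> u) \<and> y \<in> bdry (inserted \<tau> \<delta> w) \<and>
         assoc_edge \<tau> \<delta> u x = assoc_edge \<tau> \<delta> w y)}"

lemma equiv_same_edge: "equiv (verts (pieces \<tau> \<delta>)) (same_edge \<tau> \<delta>)"
  by (rule equivI) (auto simp: same_edge_def refl_on_def sym_def trans_def)

text \<open>The class, in the quotient, of the boundary vertex of \<open>G(\<rho>)\<close> associated with
  \<open>(\<rho>, par(\<rho>))\<close>.\<close>

definition root_boundary ::
    "genealogy \<Rightarrow> decorations \<Rightarrow> (nat list \<times> nat) set" where
  "root_boundary \<tau> \<delta> =
     same_edge \<tau> \<delta> `` {([], THE x. x \<in> bdry (inserted \<tau> \<delta> []) \<and> assoc_edge \<tau> \<delta> [] x = [])}"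

type_synonym dec_vertex = "(nat list \<times> nat) set option"

definition decorated_tree :: "genealogy \<Rightarrow> decorations \<Rightarrow> dec_vertex mgraph" where
  "decorated_tree \<tau> \<delta> =
     attach_root (root_boundary \<tau> \<delta>) (identify (same_edge \<tau> \<delta>) (pieces \<tau> \<delta>))"

definition dec_root :: dec_vertex where
  "dec_root = None"

end

theory Submission
  imports Defs "HOL-Library.Sublist"
begin

text \<open>
  A connected graph is recurrent as soon as it can be exhausted by finite sets of vertices whose edge
  boundaries are disjoint and of bounded size. In the decorated tree such sets come from the backbone
  \<open>s\<^sub>0, s\<^sub>1, \<dots>\<close>: everything that does not lie below \<open>s\<^sub>i\<close> (which counts as lying below itself) is
  attached to the rest of the graph through \<open>G(s\<^sub>i)\<close> only, so it is left by at most as many edges as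
  \<open>G(s\<^sub>i)\<close> has.

  Two facts make these cuts useful. First, the part that does not lie below \<open>s\<^sub>i\<close> is finite: it
  consists of finitely many backbone vertices and of the subtrees of their normal children, which are
  critical Galton-Watson trees, almost surely finite (\<open>AE_kesten_extinction\<close>), and the inserted
  graphs are finite because their volume is. Secondly, infinitely many of the \<open>G(s\<^sub>i)\<close> have at most
  \<open>M\<close> edges, for a suitable constant \<open>M\<close>, because the pairs formed by the degree of \<open>s\<^sub>i\<close> and the
  volume of \<open>G(s\<^sub>i)\<close> are independent and identically distributed and almost surely finite
  (\<open>AE_light_graphs_on_spine\<close>). In terms of resistances: a connected graph with at most \<open>M\<close> edges has
  resistance at least \<open>1/M\<close> between any two distinct vertices, and the graphs along the backbone are
  connected in series, so the resistance from the root to infinity is infinite.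

  The criterion (\<open>recurrent_if_bounded_cuts\<close>) is a form of the theorem of Nash-Williams. Let \<open>q x\<close> be
  the probability that the walk from \<open>x\<close> never visits the root \<open>z\<close>. Then \<open>q\<close> vanishes at \<open>z\<close>, is
  harmonic elsewhere and takes values in \<open>[0, 1]\<close>. Summation by parts over one of the finite sets
  bounds the Dirichlet energy of \<open>q\<close> inside it by the sum of the increments of \<open>q\<close> over the cut.
  Since the cuts are bounded, so is the total energy; since they are disjoint, the energies of the
  cuts are summable and tend to 0, and then so does, by the Cauchy-Schwarz inequality, the bound on
  the energy inside. Hence \<open>q\<close> is constant, that is, \<open>q = 0\<close>.

  Both almost sure statements on the tree rest on one computation (\<open>measure_branching\<close>): what
  happens at a vertex is independent of what happens below its different children. It yields a
  recursion over the generations, the same for all vertices of the tree.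
\<close>

section \<open>A recurrence criterion: exhaustion with bounded cuts\<close>

text \<open>
  The finite-dimensional marginals of the trajectory are the iterated kernels of the construction of
  Ionescu-Tulcea; this is the bridge to calculations with \<^const>\<open>srw_step\<close>.
\<close>

lemma nn_integral_srw_restrict:
  fixes G :: "('v, 'z) mgraph_scheme"
  assumes f: "f \<in> borel_measurable (PiM {0..<N} (\<lambda>_. count_space UNIV))"
  shows "(\<integral>\<^sup>+X. f (restrict X {0..<N}) \<partial>srw G x0)
       = (\<integral>\<^sup>+X. f X \<partial>Ionescu_Tulcea.C (srw_kernel G x0) (\<lambda>_. count_space UNIV) 0 N (\<lambda>_. undefined))"
proof -
  interpret IT: Ionescu_Tulcea "srw_kernel G x0" "\<lambda>_. count_space UNIV"
    by (rule Ionescu_Tulcea_srw)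
  let ?M = "\<lambda>_::nat. count_space (UNIV::'v set)"
  have CI: "IT.CI {0..<N} = IT.C 0 N (\<lambda>_. undefined)"
  proof (rule measure_eqI)
    show "sets (IT.CI {0..<N}) = sets (IT.C 0 N (\<lambda>_. undefined))"
      by (simp add: IT.CI_def IT.sets_C)
    fix A assume "A \<in> sets (IT.CI {0..<N})"
    then have A: "A \<in> sets (PiM {0..<N} ?M)"
      by (simp add: IT.CI_def)
    have "prod_emb {0..<N} ?M {0..<N} A = A"
      using A by (rule prod_emb_id[OF sets.sets_into_space[THEN subset_trans]]) (simp add: space_PiM)
    then show "emeasure (IT.CI {0..<N}) A = emeasure (IT.C 0 N (\<lambda>_. undefined)) A"
      using IT.emeasure_CI[OF _ A, of N] by simp
  qed
  have "(\<integral>\<^sup>+X. f X \<partial>distr IT.PF.lim (PiM {0..<N} ?M) (\<lambda>X. restrict X {0..<N}))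
      = (\<integral>\<^sup>+X. f (restrict X {0..<N}) \<partial>IT.PF.lim)"
    using f by (intro nn_integral_distr)
      (auto simp: measurable_cong_sets[OF IT.PF.sets_lim refl] intro!: measurable_restrict_subset)
  then show ?thesis
    by (simp add: srw_def IT.distr_lim CI)
qed

text \<open>
  The Markov property, in the form in which the past enters through an arbitrary event \<open>A\<close> that is
  determined by the first \<open>n + 1\<close> positions.
\<close>

lemma srw_markov:
  fixes G :: "('v, 'z) mgraph_scheme" and \<phi> :: "'v \<Rightarrow> ennreal"
  assumes A: "A \<in> sets (PiM {0..<Suc n} (\<lambda>_. count_space UNIV))"
  shows "(\<integral>\<^sup>+X. indicator A (restrict X {0..<Suc n}) * \<phi> (X (Suc n)) \<partial>srw G x0)
       = (\<integral>\<^sup>+X. indicator A (restrict X {0..<Suc n}) *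
              (\<integral>\<^sup>+y. \<phi> y \<partial>measure_pmf (srw_step G (X n))) \<partial>srw G x0)"
proof -
  interpret IT: Ionescu_Tulcea "srw_kernel G x0" "\<lambda>_. count_space UNIV"
    by (rule Ionescu_Tulcea_srw)
  let ?M = "\<lambda>_::nat. count_space (UNIV::'v set)"
  let ?C = "\<lambda>N. IT.C 0 N (\<lambda>_. undefined)"
  let ?f = "\<lambda>X. indicator A (restrict X {0..<Suc n}) * \<phi> (X (Suc n)) :: ennreal"
  let ?g = "\<lambda>X. indicator A X * (\<integral>\<^sup>+y. \<phi> y \<partial>measure_pmf (srw_step G (X n))) :: ennreal"
  have coord: "(\<lambda>X. \<psi> (X i)) \<in> borel_measurable (PiM {0..<N} ?M)" if "i < N" for \<psi> :: "'v \<Rightarrow> ennreal" and i N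
    using that by (intro measurable_compose[OF measurable_component_singleton]) auto
  have f: "?f \<in> borel_measurable (PiM {0..<Suc (Suc n)} ?M)"
    using A by (intro borel_measurable_times_ennreal coord measurable_compose[OF measurable_restrict_subset])
      auto
  have g: "?g \<in> borel_measurable (PiM {0..<Suc n} ?M)"
    using A by (intro borel_measurable_times_ennreal coord[where \<psi> = "\<lambda>x. (\<integral>\<^sup>+y. \<phi> y \<partial>measure_pmf (srw_step G x))"])
      auto
  have "(\<integral>\<^sup>+X. ?f X \<partial>srw G x0) = (\<integral>\<^sup>+X. ?f (restrict X {0..<Suc (Suc n)}) \<partial>srw G x0)"
    by (intro nn_integral_cong) (simp add: min_def restrict_restrict Int_absorb1 ivl_subset)
  also have "\<dots> = (\<integral>\<^sup>+X. ?f X \<partial>?C (Suc (Suc n)))"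
    by (rule nn_integral_srw_restrict[OF f])
  also have "\<dots> = (\<integral>\<^sup>+\<omega>. (\<integral>\<^sup>+X. ?f X \<partial>IT.eP (Suc n) \<omega>) \<partial>?C (Suc n))"
  proof -
    have C: "?C (Suc (Suc n)) = ?C (Suc n) \<bind> IT.eP (Suc n)"
      using IT.C.simps(2)[of 0 "Suc n"] by simp
    have s: "sets (?C (Suc n)) = sets (PiM {0..<Suc n} ?M)"
      using IT.sets_C[of "\<lambda>_. undefined" 0 "Suc n"] by simp
    have "IT.eP (Suc n) \<in> measurable (?C (Suc n)) (subprob_algebra (PiM {0..<Suc (Suc n)} ?M))"
      unfolding measurable_cong_sets[OF s refl] by (rule IT.measurable_eP)
    then show ?thesis
      unfolding C by (rule nn_integral_bind[OF f])
  qed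
  also have "\<dots> = (\<integral>\<^sup>+\<omega>. ?g \<omega> \<partial>?C (Suc n))"
  proof (rule nn_integral_cong)
    fix \<omega> assume "\<omega> \<in> space (?C (Suc n))"
    then have \<omega>: "\<omega> \<in> space (PiM {0..<Suc n} ?M)"
      by (simp add: IT.space_C del: IT.C.simps)
    then have r: "restrict (fun_upd \<omega> (Suc n) x) {0..<Suc n} = \<omega>" for x
      by (auto simp: space_PiM PiE_def extensional_def fun_eq_iff)
    show "(\<integral>\<^sup>+X. ?f X \<partial>IT.eP (Suc n) \<omega>) = ?g \<omega>"
      by (subst IT.nn_integral_eP[OF \<omega> f])
         (simp add: r nn_integral_cmult del: restrict_apply fun_upd_apply, simp)
  qed
  also have "\<dots> = (\<integral>\<^sup>+X. ?g (restrict X {0..<Suc n}) \<partial>srw G x0)"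
    by (rule nn_integral_srw_restrict[OF g, symmetric])
  finally show ?thesis by simp
qed

lemma AE_srw_0: "AE X in srw G x0. X 0 = x0"
proof -
  interpret IT: Ionescu_Tulcea "srw_kernel G x0" "\<lambda>_. count_space UNIV"
    by (rule Ionescu_Tulcea_srw)
  let ?M = "\<lambda>_::nat. count_space (UNIV::'a set)"
  have sets: "sets (srw G x0) = sets (PiM UNIV ?M)"
    by (simp add: srw_def IT.PF.sets_lim)
  let ?f = "\<lambda>X. indicator (- {x0}) (X 0) :: ennreal"
  have f: "?f \<in> borel_measurable (PiM {0..<Suc 0} ?M)"
    by (intro measurable_compose[OF measurable_component_singleton]) auto
  have f': "?f \<in> borel_measurable (srw G x0)"
    unfolding measurable_cong_sets[OF sets refl]
    by (intro measurable_compose[OF measurable_component_singleton]) auto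
  have "(\<integral>\<^sup>+X. ?f X \<partial>srw G x0) = (\<integral>\<^sup>+X. ?f (restrict X {0..<Suc 0}) \<partial>srw G x0)"
    by simp
  also have "\<dots> = (\<integral>\<^sup>+X. ?f X \<partial>IT.C 0 (Suc 0) (\<lambda>_. undefined))"
    by (rule nn_integral_srw_restrict[OF f])
  also have "\<dots> = (\<integral>\<^sup>+X. ?f X \<partial>IT.eP 0 (\<lambda>_. undefined))"
    using bind_return[OF IT.measurable_eP[of 0], of "\<lambda>_. undefined"] by simp
  also have "\<dots> = 0"
    by (subst IT.nn_integral_eP[OF _ f]) (simp_all add: nn_integral_return)
  finally have "AE X in srw G x0. ?f X = 0"
    using f' by (simp add: nn_integral_0_iff_AE)
  then show ?thesis
    by eventually_elim (simp split: split_indicator_asm)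
qed

lemma sets_srw: "sets (srw G x0) = sets (PiM UNIV (\<lambda>_. count_space UNIV))"
proof -
  interpret IT: Ionescu_Tulcea "srw_kernel G x0" "\<lambda>_. count_space UNIV"
    by (rule Ionescu_Tulcea_srw)
  show ?thesis
    by (simp add: srw_def IT.PF.sets_lim)
qed

lemma space_srw: "space (srw G x0) = UNIV"
  using sets_eq_imp_space_eq[OF sets_srw] by (simp add: space_PiM)

lemma measurable_srw_coordinate: "(\<lambda>X. X n) \<in> srw G x0 \<rightarrow>\<^sub>M count_space UNIV"
  unfolding measurable_cong_sets[OF sets_srw refl] by (rule measurable_component_singleton) simp

lemma AE_srw_in_closed_set:
  assumes x0: "x0 \<in> W" and W: "\<And>x. x \<in> W \<Longrightarrow> set_pmf (srw_step G x) \<subseteq> W"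
  shows "AE X in srw G x0. \<forall>n. X n \<in> W"
proof -
  have "AE X in srw G x0. X n \<in> W" for n
  proof (induction n)
    case 0
    then show ?case using AE_srw_0[of x0 G] x0 by auto
  next
    case (Suc n)
    let ?M = "\<lambda>_::nat. count_space (UNIV::'a set)"
    let ?A = "{\<omega> \<in> space (PiM {0..<Suc n} ?M). \<omega> n \<in> W}"
    have A: "?A \<in> sets (PiM {0..<Suc n} ?M)"
      by (rule measurable_sets_Collect[OF measurable_component_singleton]) auto
    have ind: "indicator ?A (restrict X {0..<Suc n}) = (indicator W (X n) :: ennreal)" for X
      by (auto simp: space_PiM split: split_indicator)
    have "(\<integral>\<^sup>+X. indicator W (X n) * indicator (- W) (X (Suc n)) \<partial>srw G x0)
        = (\<integral>\<^sup>+X. indicator W (X n) *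
             (\<integral>\<^sup>+y. indicator (- W) y \<partial>measure_pmf (srw_step G (X n))) \<partial>srw G x0)"
      using srw_markov[OF A, where \<phi> = "indicator (- W)" and G = G and ?x0.0 = x0] unfolding ind .
    also have "\<dots> = (\<integral>\<^sup>+X. 0 \<partial>srw G x0)"
    proof (rule nn_integral_cong)
      fix X :: "nat \<Rightarrow> 'a"
      have "emeasure (measure_pmf (srw_step G (X n))) (- W) = 0" if "X n \<in> W"
        using W[OF that] by (auto simp: measure_pmf.emeasure_eq_measure measure_pmf_zero_iff)
      then show "indicator W (X n) * (\<integral>\<^sup>+y. indicator (- W) y \<partial>measure_pmf (srw_step G (X n))) = (0::ennreal)"
        by (auto split: split_indicator)
    qed
    finally have "(\<integral>\<^sup>+X. indicator W (X n) * indicator (- W) (X (Suc n)) \<partial>srw G x0) = (0::ennreal)"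
      by simp
    then have "AE X in srw G x0. indicator W (X n) * indicator (- W) (X (Suc n)) = (0::ennreal)"
      by (subst (asm) nn_integral_0_iff_AE)
         (auto intro!: borel_measurable_times_ennreal measurable_compose[OF measurable_srw_coordinate])
    then show ?case
      using Suc.IH by eventually_elim (auto split: split_indicator_asm)
  qed
  then show ?thesis
    by (simp add: AE_all_countable)
qed

text \<open>
  The probability that the walk from \<open>x\<close> does not visit \<open>z\<close> at the times \<open>0, \<dots>, n\<close>, defined by
  its first-step recursion; \<open>nn_integral_srw_avoid\<close> relates it to trajectories.
\<close>

primrec avoid :: "('v, 'z) mgraph_scheme \<Rightarrow> 'v \<Rightarrow> nat \<Rightarrow> 'v \<Rightarrow> real" where
  "avoid G z 0 x = indicator (- {z}) x"
| "avoid G z (Suc n) x = indicator (- {z}) x * (\<integral>y. avoid G z n y \<partial>measure_pmf (srw_step G x))"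

lemma avoid_nonneg: "0 \<le> avoid G z n x"
  by (induction n arbitrary: x) (auto intro!: mult_nonneg_nonneg integral_nonneg)

lemma avoid_le_1: "avoid G z n x \<le> 1"
proof (induction n arbitrary: x)
  case (Suc n)
  have "(\<integral>y. avoid G z n y \<partial>measure_pmf (srw_step G x)) \<le> 1"
    using Suc by (intro measure_pmf.integral_le_const measure_pmf.integrable_const_bound[where B = 1])
      (auto simp: avoid_nonneg)
  then show ?case
    by (auto split: split_indicator)
qed (auto split: split_indicator)

lemma integrable_avoid: "integrable (measure_pmf p) (avoid G z n)"
  by (intro measure_pmf.integrable_const_bound[where B = 1]) (auto simp: avoid_nonneg avoid_le_1)

lemma avoid_at: "avoid G z n z = 0"
  by (cases n) auto

lemma decseq_avoid: "decseq (\<lambda>n. avoid G z n x)"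
proof (rule decseq_SucI)
  fix n show "avoid G z (Suc n) x \<le> avoid G z n x"
  proof (induction n arbitrary: x)
    case 0
    have "(\<integral>y. avoid G z 0 y \<partial>measure_pmf (srw_step G x)) \<le> 1"
      by (intro measure_pmf.integral_le_const integrable_avoid) (auto simp: avoid_le_1 simp del: avoid.simps)
    then show ?case
      by (auto split: split_indicator)
  next
    case (Suc n)
    have "(\<integral>y. avoid G z (Suc n) y \<partial>measure_pmf (srw_step G x)) \<le> (\<integral>y. avoid G z n y \<partial>measure_pmf (srw_step G x))"
      by (intro integral_mono integrable_avoid Suc)
    then show ?case
      unfolding avoid.simps(2)[of G z "Suc n"] avoid.simps(2)[of G z n x]
      by (intro mult_left_mono) (simp_all del: avoid.simps)
  qed
qed

text \<open>
  The Markov property is applied from the last step backwards: each application removes one time from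
  the event and adds one to the index of \<^const>\<open>avoid\<close>.
\<close>

lemma nn_integral_srw_avoid:
  "(\<integral>\<^sup>+X. indicator {X. \<forall>i<n. X (m + i) \<noteq> z} X * ennreal (avoid G z k (X (m + n))) \<partial>srw G x0)
     = (\<integral>\<^sup>+X. ennreal (avoid G z (n + k) (X m)) \<partial>srw G x0)"
proof (induction n arbitrary: k)
  case 0
  then show ?case by simp
next
  case (Suc n)
  let ?M = "\<lambda>_::nat. count_space (UNIV::'a set)"
  let ?N = "Suc (m + n)"
  let ?A = "{\<omega> \<in> space (PiM {0..<?N} ?M). \<forall>i\<in>{..n}. \<omega> (m + i) \<noteq> z}"
  have A: "?A \<in> sets (PiM {0..<?N} ?M)"
  proof (rule sets.sets_Collect_finite_All')
    fix i assume "i \<in> {..n}"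
    then show "{\<omega> \<in> space (PiM {0..<?N} ?M). \<omega> (m + i) \<noteq> z} \<in> sets (PiM {0..<?N} ?M)"
      by (intro measurable_sets_Collect[OF measurable_component_singleton]) auto
  qed auto
  have ind: "indicator ?A (restrict X {0..<?N}) = (indicator {X. \<forall>i<Suc n. X (m + i) \<noteq> z} X :: ennreal)" for X
    by (auto simp: space_PiM less_Suc_eq_le split: split_indicator)
  have "(\<integral>\<^sup>+X. indicator {X. \<forall>i<Suc n. X (m + i) \<noteq> z} X * ennreal (avoid G z k (X (m + Suc n))) \<partial>srw G x0)
      = (\<integral>\<^sup>+X. indicator {X. \<forall>i<Suc n. X (m + i) \<noteq> z} X *
           (\<integral>\<^sup>+y. ennreal (avoid G z k y) \<partial>measure_pmf (srw_step G (X (m + n)))) \<partial>srw G x0)"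
    using srw_markov[OF A, where \<phi> = "\<lambda>x. ennreal (avoid G z k x)" and G = G and ?x0.0 = x0] unfolding ind by simp
  also have "\<dots> = (\<integral>\<^sup>+X. indicator {X. \<forall>i<n. X (m + i) \<noteq> z} X * ennreal (avoid G z (Suc k) (X (m + n))) \<partial>srw G x0)"
    by (intro nn_integral_cong)
       (auto simp: nn_integral_eq_integral[OF integrable_avoid] avoid_nonneg less_Suc_eq split: split_indicator)
  also have "\<dots> = (\<integral>\<^sup>+X. ennreal (avoid G z (n + Suc k) (X m)) \<partial>srw G x0)"
    by (rule Suc)
  finally show ?case by simp
qed

text \<open>
  For every \<open>m\<close>, the probability that the walk does not visit \<open>z\<close> after time \<open>m\<close> is at most the
  expectation of \<open>avoid G z n (X m)\<close> for all \<open>n\<close>, hence 0 by dominated convergence.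
\<close>

lemma recurrent_if_avoid_tendsto_0:
  assumes lim: "AE X in srw G z. \<forall>m. (\<lambda>n. avoid G z n (X m)) \<longlonglongrightarrow> 0"
  shows "recurrent G z"
proof -
  interpret prob_space "srw G z" by (rule prob_space_srw)
  have "AE X in srw G z. \<exists>i. X (m + i) = z" for m
  proof -
    let ?B = "{X. \<forall>i. X (m + i) \<noteq> z}"
    have B: "?B \<in> sets (srw G z)"
      using sets.sets_Collect_countable_All[of "srw G z" "\<lambda>i X. X (m + i) \<noteq> z"]
        measurable_sets_Collect[OF measurable_srw_coordinate[where G = G and ?x0.0 = z], where P = "\<lambda>x. x \<noteq> z"]
      by (simp add: space_srw)
    have "(\<lambda>n. \<integral>\<^sup>+X. ennreal (avoid G z n (X m)) \<partial>srw G z) \<longlonglongrightarrow> (\<integral>\<^sup>+X. 0 \<partial>srw G z)"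
    proof (rule nn_integral_dominated_convergence[where w = "\<lambda>_. 1"])
      show "AE X in srw G z. (\<lambda>n. ennreal (avoid G z n (X m))) \<longlonglongrightarrow> 0"
        using lim by eventually_elim (use tendsto_ennrealI in fastforce)
    qed (auto simp: avoid_le_1 avoid_nonneg ennreal_le_1 emeasure_space_1
          intro!: measurable_compose[OF measurable_srw_coordinate])
    moreover have "emeasure (srw G z) ?B \<le> (\<integral>\<^sup>+X. ennreal (avoid G z n (X m)) \<partial>srw G z)" for n
    proof -
      have "emeasure (srw G z) ?B = (\<integral>\<^sup>+X. indicator ?B X \<partial>srw G z)"
        using B by simp
      also have "\<dots> \<le> (\<integral>\<^sup>+X. indicator {X. \<forall>i<n. X (m + i) \<noteq> z} X * ennreal (avoid G z 0 (X (m + n))) \<partial>srw G z)"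
        by (intro nn_integral_mono) (auto split: split_indicator)
      also have "\<dots> = (\<integral>\<^sup>+X. ennreal (avoid G z n (X m)) \<partial>srw G z)"
        by (subst nn_integral_srw_avoid) simp
      finally show ?thesis .
    qed
    ultimately have "emeasure (srw G z) ?B \<le> 0"
      by (intro LIMSEQ_le_const[where X = "\<lambda>n. \<integral>\<^sup>+X. ennreal (avoid G z n (X m)) \<partial>srw G z"]) auto
    then show ?thesis
      using B by (intro AE_I[where N = ?B]) auto
  qed
  then have "AE X in srw G z. \<forall>m. \<exists>i. X (m + i) = z"
    by (simp add: AE_all_countable)
  then show ?thesis
    unfolding recurrent_def INFM_nat_le
    by eventually_elim (metis le_add1)
qed

lemma srw_step_finite:
  assumes N: "finite N" "{y. mult G x y > 0} \<subseteq> N" and w: "mult G x w > 0"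
  shows set_srw_step: "set_pmf (srw_step G x) = {y. mult G x y > 0}"
    and expectation_srw_step:
      "(\<integral>y. f y \<partial>measure_pmf (srw_step G x)) * (\<Sum>y\<in>N. real (mult G x y)) = (\<Sum>y\<in>N. real (mult G x y) * f y)"
proof -
  let ?S = "{(y, i). i < mult G x y}"
  have S: "?S = (SIGMA y:N. {..<mult G x y})"
    using N by fastforce
  have fin: "finite ?S"
    unfolding S using N by auto
  have ne: "?S \<noteq> {}"
    using w by auto
  show "set_pmf (srw_step G x) = {y. mult G x y > 0}"
    unfolding srw_step_def set_map_pmf set_pmf_of_set[OF ne fin] by (auto intro!: image_eqI[of _ fst "(_, 0)"])
  have card: "real (card ?S) = (\<Sum>y\<in>N. real (mult G x y))"
    unfolding S using N by simp
  have "(\<integral>y. f y \<partial>measure_pmf (srw_step G x)) = (\<Sum>p\<in>?S. f (fst p)) / real (card ?S)"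
    unfolding srw_step_def using ne fin by (simp add: integral_pmf_of_set)
  also have "(\<Sum>p\<in>?S. f (fst p)) = (\<Sum>y\<in>N. real (mult G x y) * f y)"
    unfolding S using N sum.Sigma[of N "\<lambda>y. {..<mult G x y}" "\<lambda>y _. f y"] by (simp add: split_beta)
  finally show "(\<integral>y. f y \<partial>measure_pmf (srw_step G x)) * (\<Sum>y\<in>N. real (mult G x y)) = (\<Sum>y\<in>N. real (mult G x y) * f y)"
    using ne fin card by (metis card_gt_0_iff nonzero_eq_divide_eq of_nat_0_eq_iff less_irrefl)
qed

text \<open>
  Only the sets \<open>S n\<close> and their neighbours matter, because everything that the walk can reach from \<open>z\<close>
  lies in one of them; in particular the degrees of the relevant vertices are finite.
\<close>

theorem recurrent_if_bounded_cuts: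
  fixes G :: "('v, 'z) mgraph_scheme" and S :: "nat \<Rightarrow> 'v set" and M :: real
  assumes sym: "\<And>x y. mult G x y = mult G y x"
    and fin: "\<And>n. finite (S n)"
    and mono: "\<And>n. S n \<subseteq> S (Suc n)"
    and start: "z \<in> S 0" "mult G z w > 0"
    and nbr: "\<And>n x y. x \<in> S n \<Longrightarrow> mult G x y > 0 \<Longrightarrow> y \<in> S (Suc n)"
    and cut: "\<And>n. (\<Sum>x\<in>S n. \<Sum>y\<in>S (Suc n) - S n. real (mult G x y)) \<le> M"
  shows "recurrent G z"
proof -
  define c where "c x y = real (mult G x y)" for x y
  define W where "W = {x. (z, x) \<in> {(a, b). mult G a b > 0}\<^sup>*}"
  define T where "T n = S n \<inter> W" for n
  have c_sym: "c x y = c y x" and c_nonneg: "0 \<le> c x y" for x y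
    by (simp_all add: c_def sym[of x y])
  have W_step: "y \<in> W" if "x \<in> W" "mult G x y > 0" for x y
    using that by (auto simp: W_def intro: rtrancl_into_rtrancl)
  have W_S: "\<exists>n. x \<in> S n" if "x \<in> W" for x
  proof -
    from that have "(z, x) \<in> {(a, b). mult G a b > 0}\<^sup>*"
      by (simp add: W_def)
    then show ?thesis
      by induction (use start nbr in blast)+
  qed
  have deg_pos: "\<exists>y. mult G x y > 0" if "x \<in> W" for x
  proof (cases "x = z")
    case False
    from that have "(z, x) \<in> {(a, b). mult G a b > 0}\<^sup>*"
      by (simp add: W_def)
    then show ?thesis
    proof (cases rule: rtranclE)
      case (step y)
      then show ?thesis
        using sym[of x y] by (intro exI[of _ y]) auto
    qed (use False in auto)
  qed (use start in auto)
  have T_fin: "finite (T n)" and T_mono: "T n \<subseteq> T (Suc n)" for n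
    using fin mono by (auto simp: T_def)
  have T_nbr: "y \<in> T (Suc n)" if "x \<in> T n" "mult G x y > 0" for x y n
    using that nbr W_step by (auto simp: T_def)

  define q where "q x = lim (\<lambda>n. avoid G z n x)" for x
  have lim_q: "(\<lambda>n. avoid G z n x) \<longlonglongrightarrow> q x" for x
  proof -
    obtain l where "(\<lambda>n. avoid G z n x) \<longlonglongrightarrow> l"
      using decseq_convergent[OF decseq_avoid, where B = 0] avoid_nonneg by metis
    then show ?thesis
      by (simp add: q_def limI)
  qed
  have q_nonneg: "0 \<le> q x" and q_le_1: "q x \<le> 1" for x
    using LIMSEQ_le_const[OF lim_q, of 0 x] LIMSEQ_le_const2[OF lim_q, of x 1]
    by (auto simp: avoid_nonneg avoid_le_1)
  have q_z: "q z = 0"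
    using lim_q[of z] by (simp add: avoid_at LIMSEQ_const_iff)
  have harmonic: "(\<Sum>y\<in>T (Suc n). c x y * (q x - q y)) = 0" if x: "x \<in> T n" "x \<noteq> z" for n x
  proof -
    let ?N = "T (Suc n)"
    have N: "finite ?N" "{y. mult G x y > 0} \<subseteq> ?N"
      using T_fin T_nbr x by auto
    obtain y0 where y0: "mult G x y0 > 0"
      using deg_pos x by (auto simp: T_def)
    have "(\<lambda>n. avoid G z (Suc n) x * (\<Sum>y\<in>?N. c x y)) \<longlonglongrightarrow> q x * (\<Sum>y\<in>?N. c x y)"
      by (intro tendsto_intros LIMSEQ_Suc lim_q)
    moreover have "avoid G z (Suc n) x * (\<Sum>y\<in>?N. c x y) = (\<Sum>y\<in>?N. c x y * avoid G z n y)" for n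
      using expectation_srw_step[OF N y0, of "avoid G z n"] x by (simp add: c_def)
    moreover have "(\<lambda>n. \<Sum>y\<in>?N. c x y * avoid G z n y) \<longlonglongrightarrow> (\<Sum>y\<in>?N. c x y * q y)"
      by (intro tendsto_intros lim_q)
    ultimately have "q x * (\<Sum>y\<in>?N. c x y) = (\<Sum>y\<in>?N. c x y * q y)"
      using LIMSEQ_unique by fastforce
    then show ?thesis
      by (simp add: right_diff_distrib sum_subtractf sum_distrib_left mult.commute)
  qed

  \<comment> \<open>\<open>E n\<close> is twice the energy inside \<open>T n\<close>, and \<open>D n\<close> and \<open>F n\<close> are the energy of the cut and
    the total variation of \<open>q\<close> over it. Cuts are disjoint, so \<open>E n + D n \<le> E (Suc n)\<close>.\<close>
  define bd where "bd n = T (Suc n) - T n" for n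
  define E where "E n = (\<Sum>x\<in>T n. \<Sum>y\<in>T n. c x y * (q x - q y)\<^sup>2)" for n
  define D where "D n = (\<Sum>x\<in>T n. \<Sum>y\<in>bd n. c x y * (q x - q y)\<^sup>2)" for n
  define F where "F n = (\<Sum>x\<in>T n. \<Sum>y\<in>bd n. c x y * \<bar>q x - q y\<bar>)" for n
  have split: "(\<Sum>y\<in>T (Suc n). f y) = (\<Sum>y\<in>T n. f y) + (\<Sum>y\<in>bd n. f y)" for n and f :: "'v \<Rightarrow> real"
    unfolding bd_def using sum.subset_diff[OF T_mono T_fin] by (simp add: add.commute)
  have bd_fin: "finite (bd n)" for n
    by (simp add: bd_def T_fin)

  have cut_T: "(\<Sum>x\<in>T n. \<Sum>y\<in>bd n. c x y) \<le> M" for n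
  proof -
    have "(\<Sum>x\<in>T n. \<Sum>y\<in>bd n. c x y) \<le> (\<Sum>x\<in>S n. \<Sum>y\<in>bd n. c x y)"
      using fin by (intro sum_mono2) (auto simp: T_def c_nonneg intro!: sum_nonneg)
    also have "\<dots> \<le> (\<Sum>x\<in>S n. \<Sum>y\<in>S (Suc n) - S n. c x y)"
      using fin by (intro sum_mono sum_mono2) (auto simp: bd_def T_def c_nonneg)
    finally show ?thesis
      using cut[of n] by (simp add: c_def)
  qed

  \<comment> \<open>Summation by parts: multiply harmonicity at \<open>x\<close> by \<open>q x\<close> and sum over \<open>T n\<close>.\<close>
  have E_F: "E n / 2 \<le> F n" for n
  proof -
    have "0 = (\<Sum>x\<in>T n. q x * (\<Sum>y\<in>T (Suc n). c x y * (q x - q y)))"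
      by (rule sum.neutral[symmetric]) (use harmonic q_z in force)
    also have "\<dots> = (\<Sum>x\<in>T n. \<Sum>y\<in>T n. c x y * (q x * (q x - q y))) + (\<Sum>x\<in>T n. \<Sum>y\<in>bd n. c x y * (q x * (q x - q y)))"
      by (simp add: split sum.distrib distrib_left sum_distrib_left algebra_simps)
    also have "(\<Sum>x\<in>T n. \<Sum>y\<in>T n. c x y * (q x * (q x - q y))) = E n / 2"
    proof -
      let ?s = "\<Sum>x\<in>T n. \<Sum>y\<in>T n. c x y * (q x * (q x - q y))"
      have "?s = (\<Sum>x\<in>T n. \<Sum>y\<in>T n. c x y * (q y * (q y - q x)))"
        by (subst sum.swap) (simp add: c_sym)
      then have "2 * ?s = (\<Sum>x\<in>T n. \<Sum>y\<in>T n. c x y * (q x * (q x - q y)) + c x y * (q y * (q y - q x)))"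
        by (simp add: sum.distrib)
      also have "\<dots> = E n"
        unfolding E_def by (intro sum.cong refl) (simp add: power2_eq_square algebra_simps)
      finally show ?thesis by simp
    qed
    finally have "E n / 2 = (\<Sum>x\<in>T n. \<Sum>y\<in>bd n. c x y * (q x * (q y - q x)))"
      by (simp add: right_diff_distrib sum_subtractf algebra_simps)
    also have "\<dots> \<le> F n"
      unfolding F_def
    proof (intro sum_mono mult_left_mono c_nonneg)
      fix x y
      have "q x * (q y - q x) \<le> q x * \<bar>q x - q y\<bar>"
        by (intro mult_left_mono q_nonneg) simp
      also have "\<dots> \<le> 1 * \<bar>q x - q y\<bar>"
        by (intro mult_right_mono q_le_1) simp
      finally show "q x * (q y - q x) \<le> \<bar>q x - q y\<bar>" by simp
    qed
    finally show ?thesis .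
  qed
  \<comment> \<open>The Cauchy-Schwarz inequality in the additive form \<open>t \<le> \<eta> / 2 + t\<^sup>2 / (2 \<eta>)\<close>.\<close>
  have F_le: "F n \<le> \<eta> * M / 2 + D n / (2 * \<eta>)" if \<eta>: "\<eta> > 0" for n \<eta>
  proof -
    have "F n \<le> (\<Sum>x\<in>T n. \<Sum>y\<in>bd n. c x y * (\<eta> / 2 + (q x - q y)\<^sup>2 / (2 * \<eta>)))"
      unfolding F_def
    proof (intro sum_mono mult_left_mono c_nonneg)
      fix x y
      have "0 \<le> (\<eta> - \<bar>q x - q y\<bar>)\<^sup>2" by simp
      then show "\<bar>q x - q y\<bar> \<le> \<eta> / 2 + (q x - q y)\<^sup>2 / (2 * \<eta>)"
        using \<eta> by (simp add: field_simps power2_eq_square)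
    qed
    also have "\<dots> = \<eta> / 2 * (\<Sum>x\<in>T n. \<Sum>y\<in>bd n. c x y) + D n / (2 * \<eta>)"
      by (simp add: D_def distrib_left sum.distrib sum_distrib_left sum_divide_distrib mult.commute)
    also have "\<dots> \<le> \<eta> / 2 * M + D n / (2 * \<eta>)"
      using \<eta> by (intro add_right_mono mult_left_mono cut_T) simp
    finally show ?thesis by simp
  qed
  have F_M: "F n \<le> M" for n
  proof -
    have "F n \<le> (\<Sum>x\<in>T n. \<Sum>y\<in>bd n. c x y * 1)"
      unfolding F_def
    proof (intro sum_mono mult_left_mono c_nonneg)
      fix x y show "\<bar>q x - q y\<bar> \<le> 1"
        using q_nonneg[of x] q_nonneg[of y] q_le_1[of x] q_le_1[of y] by linarith
    qed
    with cut_T[of n] show ?thesis by simp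
  qed
  have D_nonneg: "0 \<le> D n" for n
    unfolding D_def by (intro sum_nonneg mult_nonneg_nonneg c_nonneg) simp
  have E_step: "E n + D n \<le> E (Suc n)" for n
  proof -
    have "E n + D n = (\<Sum>x\<in>T n. \<Sum>y\<in>T (Suc n). c x y * (q x - q y)\<^sup>2)"
      by (simp add: E_def D_def split sum.distrib)
    also have "\<dots> \<le> E (Suc n)"
      unfolding E_def using T_mono T_fin
      by (intro sum_mono2 sum_nonneg mult_nonneg_nonneg c_nonneg) auto
    finally show ?thesis .
  qed
  have E_inc: "incseq E"
    by (rule incseq_SucI) (use E_step D_nonneg in \<open>metis add_increasing2 order_trans order_refl\<close>)
  have E_bound: "E n \<le> 2 * M" for n
    using E_F[of n] F_M[of n] by simp
  obtain e where e: "E \<longlonglongrightarrow> e"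
    using incseq_convergent[OF E_inc] E_bound by metis
  have D_0: "D \<longlonglongrightarrow> 0"
  proof (rule tendsto_sandwich[of "\<lambda>_. 0"])
    show "(\<lambda>n. E (Suc n) - E n) \<longlonglongrightarrow> 0"
      using tendsto_diff[OF LIMSEQ_Suc[OF e] e] by simp
    have "D n \<le> E (Suc n) - E n" for n
      using E_step[of n] by simp
    then show "eventually (\<lambda>n. D n \<le> E (Suc n) - E n) sequentially"
      by simp
  qed (auto simp: D_nonneg)
  have "e \<le> \<eta> * M" if \<eta>: "\<eta> > 0" for \<eta>
  proof -
    have "E n \<le> \<eta> * M + D n / \<eta>" for n
    proof -
      have "2 * (\<eta> * M / 2 + D n / (2 * \<eta>)) = \<eta> * M + D n / \<eta>"
        using \<eta> by (simp add: field_simps)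
      then show ?thesis
        using E_F[of n] F_le[OF \<eta>, of n] by linarith
    qed
    moreover have "(\<lambda>n. \<eta> * M + D n / \<eta>) \<longlonglongrightarrow> \<eta> * M + 0 / \<eta>"
      by (intro tendsto_intros D_0) (use \<eta> in auto)
    ultimately show ?thesis
      using LIMSEQ_le[OF e] by fastforce
  qed
  \<comment> \<open>Let \<open>\<eta>\<close> tend to 0.\<close>
  then have e_le: "e \<le> 0"
  proof -
    assume *: "\<And>\<eta>. \<eta> > 0 \<Longrightarrow> e \<le> \<eta> * M"
    have "((\<lambda>\<eta>. \<eta> * M) \<longlongrightarrow> 0 * M) (at_right 0)"
      by (intro tendsto_intros)
    then show "e \<le> 0"
      using * by (intro tendsto_lowerbound[where F = "at_right 0" and f = "\<lambda>\<eta>. \<eta> * M"])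
        (auto simp: eventually_at_right_less elim: eventually_mono[OF eventually_at_right_less])
  qed
  have q_edge: "q x = q y" if "x \<in> W" "mult G x y > 0" for x y
  proof -
    obtain n where n: "x \<in> S n" by (metis W_S \<open>x \<in> W\<close>)
    then have xy: "x \<in> T (Suc n)" "y \<in> T (Suc n)"
      using that T_nbr[of x n y] T_mono[of n] by (auto simp: T_def)
    have "c x y * (q x - q y)\<^sup>2 \<le> (\<Sum>y\<in>T (Suc n). c x y * (q x - q y)\<^sup>2)"
      using xy T_fin by (intro member_le_sum mult_nonneg_nonneg c_nonneg) auto
    also have "\<dots> \<le> E (Suc n)"
      unfolding E_def using xy T_fin
      by (intro member_le_sum[where f = "\<lambda>x. \<Sum>y\<in>T (Suc n). c x y * (q x - q y)\<^sup>2"]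
            sum_nonneg mult_nonneg_nonneg c_nonneg) auto
    also have "\<dots> \<le> e"
      using incseq_le[OF E_inc e] .
    finally have "c x y * (q x - q y)\<^sup>2 \<le> 0"
      using e_le by simp
    then show ?thesis
      using that by (simp add: c_def mult_le_0_iff)
  qed
  have q_0: "q x = 0" if "x \<in> W" for x
  proof -
    from that have "(z, x) \<in> {(a, b). mult G a b > 0}\<^sup>*"
      by (simp add: W_def)
    then show ?thesis
    proof induction
      case (step y x)
      then show ?case using q_edge[of y x] by (simp add: W_def)
    qed (rule q_z)
  qed
  have "AE X in srw G z. \<forall>n. X n \<in> W"
  proof (rule AE_srw_in_closed_set)
    fix x assume x: "x \<in> W"
    obtain n where n: "x \<in> S n" by (metis W_S x)
    obtain y0 where y0: "mult G x y0 > 0"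
      using deg_pos x by auto
    have "{y. mult G x y > 0} \<subseteq> S (Suc n)"
      using nbr n by auto
    from set_srw_step[OF fin this y0] show "set_pmf (srw_step G x) \<subseteq> W"
      using W_step x by auto
  qed (simp add: W_def)
  then show ?thesis
    by (intro recurrent_if_avoid_tendsto_0; eventually_elim) (metis q_0 lim_q)
qed

section \<open>The backbone and the finite subtrees off it\<close>

text \<open>
  The backbone vertices \<open>s\<^sub>0, s\<^sub>1, \<dots>\<close>.
\<close>

primrec spine :: "genealogy \<Rightarrow> nat \<Rightarrow> nat list" where
  "spine \<tau> 0 = []"
| "spine \<tau> (Suc i) = spine \<tau> i @ [snd (snd (\<tau> (spine \<tau> i)))]"

lemma length_spine [simp]: "length (spine \<tau> i) = i"
  by (induction i) auto

lemma spine_special: "spine \<tau> i \<in> special \<tau>"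
proof (induction i)
  case (Suc i)
  then show ?case
    using special.child[of "spine \<tau> i" \<tau> "fst (\<tau> (spine \<tau> i))"] by (simp add: prod_eq_iff)
qed (simp add: special.root)

text \<open>
  Used to see that the children of \<open>s\<^sub>i\<close> other than \<open>s\<^sub>i\<^sub>+\<^sub>1\<close> are normal.
\<close>

lemma special_eq_spine: "u \<in> special \<tau> \<Longrightarrow> u = spine \<tau> (length u)"
  by (induction rule: special.induct) auto

lemma special_appendD: "u @ w \<in> special \<tau> \<Longrightarrow> u \<in> special \<tau>"
proof (induction w rule: rev_induct)
  case (snoc j w)
  from snoc.prems have "u @ w \<in> special \<tau>"
    by (cases rule: special.cases) auto
  then show ?case by (rule snoc.IH)
qed simp

lemma strict_prefix_spine: "i < j \<Longrightarrow> strict_prefix (spine \<tau> i) (spine \<tau> j)"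
proof (induction j)
  case (Suc j)
  then show ?case
    by (cases "i = j") (auto simp: strict_prefix_def)
qed simp

lemma tree_snocD: "u @ [j] \<in> tree \<tau> \<Longrightarrow> u \<in> tree \<tau> \<and> j \<in> {1..num_children \<tau> u}"
  by (erule tree.cases) auto

lemma tree_appendD: "u @ w \<in> tree \<tau> \<Longrightarrow> u \<in> tree \<tau>"
proof (induction w rule: rev_induct)
  case (snoc j w)
  then show ?case
    using tree_snocD[of "u @ w" j \<tau>] by simp
qed simp

text \<open>
  The induction step of the proofs that parts of the tree are finite.
\<close>

lemma tree_below:
  assumes w: "w \<in> tree \<tau>" "prefix u w"
  shows "w = u \<or> (\<exists>j\<in>{1..num_children \<tau> u}. prefix (u @ [j]) w)"
proof (cases "w = u")
  case False
  then obtain j ws where ws: "w = u @ j # ws"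
    using w by (metis append_Nil2 list.exhaust prefixE)
  then have "u @ [j] \<in> tree \<tau>"
    using tree_appendD[of "u @ [j]" ws \<tau>] w by simp
  then have "j \<in> {1..num_children \<tau> u}"
    using tree_snocD by blast
  moreover have "prefix (u @ [j]) w"
    by (simp add: ws)
  ultimately show ?thesis by blast
qed simp

text \<open>
  The individual \<open>u\<close> has descendants \<open>n\<close> generations later, if \<open>u\<close> and its descendants are all
  treated as normal. This is what happens in the tree if \<open>u\<close> is normal. Ignoring whether \<open>u\<close> is
  special makes the event depend on the subtree below \<open>u\<close> only, and its probability independent of
  \<open>u\<close>.
\<close>

primrec reaches :: "genealogy \<Rightarrow> nat \<Rightarrow> nat list \<Rightarrow> bool" where
  "reaches \<tau> 0 u \<longleftrightarrow> True"
| "reaches \<tau> (Suc n) u \<longleftrightarrow> (\<exists>j\<in>{1..fst (\<tau> u)}. reaches \<tau> n (u @ [j]))"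

lemma num_children_normal: "u \<notin> special \<tau> \<Longrightarrow> num_children \<tau> u = fst (\<tau> u)"
  by (auto simp: num_children_def split: prod.split)

lemma num_children_special: "u \<in> special \<tau> \<Longrightarrow> num_children \<tau> u = fst (snd (\<tau> u))"
  by (auto simp: num_children_def split: prod.split)

lemma finite_bush:
  "\<not> reaches \<tau> n u \<Longrightarrow> u \<notin> special \<tau> \<Longrightarrow> finite {w \<in> tree \<tau>. prefix u w}"
proof (induction n arbitrary: u)
  case (Suc n)
  have "{w \<in> tree \<tau>. prefix u w} \<subseteq> insert u (\<Union>j\<in>{1..fst (\<tau> u)}. {w \<in> tree \<tau>. prefix (u @ [j]) w})"
  proof
    fix w assume "w \<in> {w \<in> tree \<tau>. prefix u w}"
    then show "w \<in> insert u (\<Union>j\<in>{1..fst (\<tau> u)}. {w \<in> tree \<tau>. prefix (u @ [j]) w})"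
      using tree_below[of w \<tau> u] num_children_normal[OF Suc.prems(2)] by auto
  qed
  moreover have "finite {w \<in> tree \<tau>. prefix (u @ [j]) w}" if "j \<in> {1..fst (\<tau> u)}" for j
    using Suc.prems that special_appendD[of u "[j]" \<tau>] by (intro Suc.IH) auto
  ultimately show ?case
    by (blast intro: finite_subset)
qed simp

text \<open>
  Passing from \<open>s\<^sub>i\<close> to \<open>s\<^sub>i\<^sub>+\<^sub>1\<close> adds \<open>s\<^sub>i\<close> itself and the subtrees of its normal children.
\<close>

lemma finite_not_below_spine:
  assumes "\<And>u. \<exists>n. \<not> reaches \<tau> n u"
  shows "finite {w \<in> tree \<tau>. \<not> prefix (spine \<tau> i) w}"
proof (induction i)
  case (Suc i)
  let ?s = "spine \<tau> i" and ?c = "snd (snd (\<tau> (spine \<tau> i)))"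
  have "{w \<in> tree \<tau>. \<not> prefix (spine \<tau> (Suc i)) w} \<subseteq>
      {w \<in> tree \<tau>. \<not> prefix ?s w} \<union>
      insert ?s (\<Union>j\<in>{1..num_children \<tau> ?s} - {?c}. {w \<in> tree \<tau>. prefix (?s @ [j]) w})"
  proof
    fix w assume "w \<in> {w \<in> tree \<tau>. \<not> prefix (spine \<tau> (Suc i)) w}"
    then have w: "w \<in> tree \<tau>" "\<not> prefix (?s @ [?c]) w"
      by simp_all
    show "w \<in> {w \<in> tree \<tau>. \<not> prefix ?s w} \<union>
        insert ?s (\<Union>j\<in>{1..num_children \<tau> ?s} - {?c}. {w \<in> tree \<tau>. prefix (?s @ [j]) w})"
    proof (cases "prefix ?s w \<and> w \<noteq> ?s")
      case True
      then obtain j where "j \<in> {1..num_children \<tau> ?s}" "prefix (?s @ [j]) w"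
        using tree_below[OF w(1)] by blast
      with w show ?thesis by blast
    qed (use w in auto)
  qed
  moreover have "finite {w \<in> tree \<tau>. prefix (?s @ [j]) w}" if "j \<in> {1..num_children \<tau> ?s} - {?c}" for j
  proof -
    have "?s @ [j] \<notin> special \<tau>"
      using special_eq_spine[of "?s @ [j]" \<tau>] that by auto
    then show ?thesis
      using assms[of "?s @ [j]"] finite_bush by blast
  qed
  ultimately show ?case
    using Suc by (blast intro: finite_subset)
qed simp

section \<open>Cuts of the decorated tree along the backbone\<close>

lemma assoc_edge_cases:
  obtains "assoc_edge \<tau> \<delta> u x = u" | j where "assoc_edge \<tau> \<delta> u x = u @ [j]"
  by (cases "assoc_edge \<tau> \<delta> u x = u") (auto simp: assoc_edge_def Let_def split: if_splits)

lemma verts_pieces: "verts (pieces \<tau> \<delta>) = (SIGMA u:tree \<tau>. verts (inserted \<tau> \<delta> u))"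
  by (simp add: pieces_def disjoint_union_def)

lemma mult_pieces:
  "mult (pieces \<tau> \<delta>) (u, x) (w, y) = (if u = w \<and> u \<in> tree \<tau> then mult (inserted \<tau> \<delta> u) x y else 0)"
  by (simp add: pieces_def disjoint_union_def)

text \<open>
  The vertices of the quotient: each comes from a single \<open>G(u)\<close> or is the point where two inserted
  graphs are joined.
\<close>

abbreviation joints :: "genealogy \<Rightarrow> decorations \<Rightarrow> (nat list \<times> nat) set set" where
  "joints \<tau> \<delta> \<equiv> verts (pieces \<tau> \<delta>) // same_edge \<tau> \<delta>"

text \<open>
  Vertices of different inserted graphs are identified only if these graphs sit at the two ends of
  one tree edge. If one end is below \<open>s\<close> and the other one is not, then this edge joins \<open>s\<close> to its parent.
\<close>

lemma crossing_joint:
  assumes A: "A \<in> joints \<tau> \<delta>" and u: "(u, x) \<in> A" "prefix s u" and w: "(w, y) \<in> A" "\<not> prefix s w"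
  shows "u = s"
proof -
  have "((u, x), (w, y)) \<in> same_edge \<tau> \<delta>"
    using A u w by (intro in_quotient_imp_in_rel[OF equiv_same_edge A]) auto
  then have e: "assoc_edge \<tau> \<delta> u x = assoc_edge \<tau> \<delta> w y"
    using u w by (auto simp: same_edge_def)
  show ?thesis
  proof (cases rule: assoc_edge_cases[of \<tau> \<delta> w y])
    case 1
    with e u w show ?thesis
      by (cases rule: assoc_edge_cases[of \<tau> \<delta> u x]) auto
  next
    case (2 j)
    with e u w show ?thesis
      by (cases rule: assoc_edge_cases[of \<tau> \<delta> u x]) auto
  qed
qed

lemma finite_joint:
  assumes fin: "\<And>u. finite (verts (inserted \<tau> \<delta> u))" and A: "A \<in> joints \<tau> \<delta>"
  shows "finite A"
proof -
  obtain u x where A': "A = same_edge \<tau> \<delta> `` {(u, x)}"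
    using A by (auto elim!: quotientE)
  let ?e = "assoc_edge \<tau> \<delta> u x"
  have "A \<subseteq> insert (u, x) (SIGMA w:{?e, butlast ?e}. verts (inserted \<tau> \<delta> w))"
  proof
    fix p assume "p \<in> A"
    then obtain w y where p: "p = (w, y)" and r: "((u, x), (w, y)) \<in> same_edge \<tau> \<delta>"
      by (cases p) (auto simp: A')
    have "w \<in> {?e, butlast ?e}" if "(w, y) \<noteq> (u, x)"
    proof -
      have "?e = assoc_edge \<tau> \<delta> w y"
        using r that by (auto simp: same_edge_def)
      then show ?thesis
        by (cases rule: assoc_edge_cases[of \<tau> \<delta> w y]) auto
    qed
    then show "p \<in> insert (u, x) (SIGMA w:{?e, butlast ?e}. verts (inserted \<tau> \<delta> w))"
      using r by (auto simp: p same_edge_def verts_pieces)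
  qed
  then show ?thesis
    using fin by (auto intro: finite_subset)
qed

text \<open>
  The vertices that meet the part of the tree that is not below \<open>s\<close>. The boundary vertex between \<open>s\<close>
  and its parent is one of them.
\<close>

definition early_joints :: "genealogy \<Rightarrow> decorations \<Rightarrow> nat list \<Rightarrow> (nat list \<times> nat) set set" where
  "early_joints \<tau> \<delta> s = {A \<in> joints \<tau> \<delta>. \<exists>p\<in>A. \<not> prefix s (fst p)}"

text \<open>
  The finite sets of the criterion. The neighbour of the root is listed explicitly, so that the root
  never contributes to a cut; by \<open>Some_early_iff\<close>, it is already an element of \<^const>\<open>early_joints\<close>
  if it is a vertex and \<open>s\<close> is not the root of the tree.
\<close>

definition early :: "genealogy \<Rightarrow> decorations \<Rightarrow> nat list \<Rightarrow> dec_vertex set" where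
  "early \<tau> \<delta> s = {None, Some (root_boundary \<tau> \<delta>)} \<union> Some ` early_joints \<tau> \<delta> s"

lemma finite_early:
  assumes fin: "\<And>u. finite (verts (inserted \<tau> \<delta> u))"
    and bush: "finite {w \<in> tree \<tau>. \<not> prefix s w}"
  shows "finite (early \<tau> \<delta> s)"
proof -
  have "early_joints \<tau> \<delta> s \<subseteq>
      (\<lambda>p. same_edge \<tau> \<delta> `` {p}) ` (SIGMA w:{w \<in> tree \<tau>. \<not> prefix s w}. verts (inserted \<tau> \<delta> w))"
  proof
    fix A assume "A \<in> early_joints \<tau> \<delta> s"
    then obtain p where "A \<in> joints \<tau> \<delta>" "p \<in> A" "\<not> prefix s (fst p)"
      unfolding early_joints_def by blast
    then obtain w y where A: "A \<in> joints \<tau> \<delta>" and w: "(w, y) \<in> A" "\<not> prefix s w"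
      by (cases p) simp
    have "(w, y) \<in> verts (pieces \<tau> \<delta>)"
      using in_quotient_imp_subset[OF equiv_same_edge A] w by auto
    moreover have "A = same_edge \<tau> \<delta> `` {(w, y)}"
      using A w by (metis Image_singleton_iff equiv_class_eq[OF equiv_same_edge] quotientE)
    ultimately show "A \<in> (\<lambda>p. same_edge \<tau> \<delta> `` {p}) `
        (SIGMA w:{w \<in> tree \<tau>. \<not> prefix s w}. verts (inserted \<tau> \<delta> w))"
      using w by (auto simp: verts_pieces)
  qed
  then have "finite (early_joints \<tau> \<delta> s)"
    using fin bush by (auto intro: finite_subset)
  then show ?thesis
    by (simp add: early_def)
qed

lemma early_joints_mono:
  assumes "prefix s s'"
  shows "early_joints \<tau> \<delta> s \<subseteq> early_joints \<tau> \<delta> s'"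
proof -
  have "\<not> prefix s' w" if "\<not> prefix s w" for w
    using prefix_order.order_trans[OF assms] that by blast
  then show ?thesis
    unfolding early_joints_def by blast
qed

lemma early_mono: "prefix s s' \<Longrightarrow> early \<tau> \<delta> s \<subseteq> early \<tau> \<delta> s'"
  using early_joints_mono[of s s' \<tau> \<delta>] by (auto simp: early_def)

lemma Some_early_iff:
  assumes "s \<noteq> []" "A \<in> joints \<tau> \<delta>"
  shows "Some A \<in> early \<tau> \<delta> s \<longleftrightarrow> A \<in> early_joints \<tau> \<delta> s"
proof -
  have "A \<in> early_joints \<tau> \<delta> s" if A: "A = root_boundary \<tau> \<delta>"
  proof -
    obtain x where x: "A = same_edge \<tau> \<delta> `` {([], x)}"
      using A by (simp add: root_boundary_def)
    have "A \<noteq> {}"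
      using in_quotient_imp_non_empty[OF equiv_same_edge assms(2)] .
    then have "([], x) \<in> A"
      unfolding x by (auto simp: same_edge_def)
    then show ?thesis
      using assms unfolding early_joints_def by force
  qed
  then show ?thesis
    by (auto simp: early_def)
qed

lemma mult_identify_pos:
  assumes "mult (identify r G) A B > 0"
  obtains x y where "A \<in> verts G // r" "B \<in> verts G // r" "x \<in> A" "y \<in> B" "mult G x y > 0"
proof -
  have AB: "A \<in> verts G // r" "B \<in> verts G // r" and ne: "(\<Sum>x\<in>A. \<Sum>y\<in>B. mult G x y) \<noteq> 0"
    using assms by (auto simp: identify_def split: if_splits)
  from ne obtain x where "x \<in> A" "(\<Sum>y\<in>B. mult G x y) \<noteq> 0"
    by (rule sum.not_neutral_contains_not_neutral)
  moreover from this(2) obtain y where "y \<in> B" "mult G x y \<noteq> 0"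
    by (rule sum.not_neutral_contains_not_neutral)
  ultimately show thesis
    using AB that by simp
qed

lemma mult_decorated_tree [simp]:
  "mult (decorated_tree \<tau> \<delta>) None None = 0"
  "mult (decorated_tree \<tau> \<delta>) None (Some B) = (if B = root_boundary \<tau> \<delta> then 1 else 0)"
  "mult (decorated_tree \<tau> \<delta>) (Some A) None = (if A = root_boundary \<tau> \<delta> then 1 else 0)"
  "mult (decorated_tree \<tau> \<delta>) (Some A) (Some B) = mult (identify (same_edge \<tau> \<delta>) (pieces \<tau> \<delta>)) A B"
  by (simp_all add: decorated_tree_def attach_root_def)

text \<open>
  An edge lies inside one inserted graph \<open>G(u)\<close>. If it leaves the early vertices, then \<open>u\<close> is below
  \<open>s\<close>, while its starting point also belongs to an inserted graph that is not. This leaves only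
  \<open>u = s\<close>.
\<close>

lemma crossing_edge:
  assumes A: "A \<in> early_joints \<tau> \<delta> s" and B: "B \<in> joints \<tau> \<delta> - early_joints \<tau> \<delta> s"
    and p: "p \<in> A" and q: "q \<in> B" and pos: "mult (pieces \<tau> \<delta>) p q > 0"
  shows "fst p = s" "fst q = s"
proof -
  obtain u x y where pq: "p = (u, x)" "q = (u, y)"
    using pos by (cases p; cases q) (auto simp: mult_pieces split: if_splits)
  have "prefix s u"
    using B q pq by (auto simp: early_joints_def)
  moreover obtain r where r: "r \<in> A" "\<not> prefix s (fst r)" "A \<in> joints \<tau> \<delta>"
    using A unfolding early_joints_def by blast
  ultimately have "u = s"
    using crossing_joint[OF r(3), of u x s "fst r" "snd r"] p pq by simp
  then show "fst p = s" "fst q = s"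
    by (simp_all add: pq)
qed

text \<open>
  An edge that leaves the early vertices for \<open>s\<close> belongs to \<open>G(s)\<close>, and \<open>s\<close> is not below \<open>s'\<close>.
\<close>

lemma early_neighbours:
  assumes s: "s \<noteq> []" "strict_prefix s s'" and a: "a \<in> early \<tau> \<delta> s"
    and pos: "mult (decorated_tree \<tau> \<delta>) a b > 0"
  shows "b \<in> early \<tau> \<delta> s'"
proof (cases a; cases b)
  fix A B assume ab: "a = Some A" "b = Some B"
  obtain p q where AB: "A \<in> joints \<tau> \<delta>" "B \<in> joints \<tau> \<delta>" and pq: "p \<in> A" "q \<in> B" "mult (pieces \<tau> \<delta>) p q > 0"
    using pos by (auto simp: ab elim: mult_identify_pos)
  have A: "A \<in> early_joints \<tau> \<delta> s"
    using a Some_early_iff[OF s(1) AB(1)] by (simp add: ab)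
  have "B \<in> early_joints \<tau> \<delta> s'"
  proof (cases "B \<in> early_joints \<tau> \<delta> s")
    case True
    then show ?thesis
      using early_joints_mono[of s s'] s(2) by (auto simp: strict_prefix_def)
  next
    case False
    then have "fst q = s"
      using crossing_edge[OF A _ pq] AB by simp
    moreover have "\<not> prefix s' s"
      using s by (metis prefix_order.less_le_not_le)
    ultimately show ?thesis
      using pq AB unfolding early_joints_def by blast
  qed
  then show ?thesis
    by (simp add: early_def ab)
qed (use pos in \<open>auto simp: early_def split: if_splits\<close>)

lemma sum_disjoint_subset_le:
  fixes f :: "'a \<Rightarrow> 'b \<Rightarrow> nat"
  assumes "finite P" "finite Q" "finite U" "finite V"
    and "\<And>p q. p \<in> P \<Longrightarrow> q \<in> Q \<Longrightarrow> f p q > 0 \<Longrightarrow> p \<in> U \<and> q \<in> V"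
  shows "(\<Sum>p\<in>P. \<Sum>q\<in>Q. f p q) \<le> (\<Sum>p\<in>U. \<Sum>q\<in>V. f p q)"
proof -
  have "(\<Sum>p\<in>P. \<Sum>q\<in>Q. f p q) = (\<Sum>(p, q)\<in>P \<times> Q. f p q)"
    by (simp add: sum.cartesian_product)
  also have "\<dots> = (\<Sum>(p, q)\<in>P \<times> Q \<inter> U \<times> V. f p q)"
    using assms by (intro sum.mono_neutral_right) auto
  also have "\<dots> \<le> (\<Sum>(p, q)\<in>U \<times> V. f p q)"
    using assms by (intro sum_mono2) auto
  finally show ?thesis
    by (simp add: sum.cartesian_product)
qed

text \<open>
  Distinct vertices of the quotient are disjoint classes, so the multiplicities of the cut are sums
  over disjoint sets of pairs, and by \<open>crossing_edge\<close> only pairs from \<open>G(s)\<close> contribute.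
\<close>

lemma cut_le:
  assumes fin: "\<And>u. finite (verts (inserted \<tau> \<delta> u))" and wf: "wf_mgraph (inserted \<tau> \<delta> s)"
    and bush: "finite {w \<in> tree \<tau>. \<not> prefix s w}" "finite {w \<in> tree \<tau>. \<not> prefix s' w}"
    and s: "s \<noteq> []"
  shows "(\<Sum>a\<in>early \<tau> \<delta> s. \<Sum>b\<in>early \<tau> \<delta> s' - early \<tau> \<delta> s. mult (decorated_tree \<tau> \<delta>) a b)
    \<le> (\<Sum>x\<in>verts (inserted \<tau> \<delta> s). \<Sum>y\<in>verts (inserted \<tau> \<delta> s). mult (inserted \<tau> \<delta> s) x y)"
proof -
  let ?Q = "early_joints \<tau> \<delta> s" and ?R = "early_joints \<tau> \<delta> s' - early_joints \<tau> \<delta> s"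
  let ?G = "decorated_tree \<tau> \<delta>" and ?V = "verts (inserted \<tau> \<delta> s)"
  have Q: "finite ?Q" and R: "finite ?R"
    using finite_early[OF fin bush(1)] finite_early[OF fin bush(2)]
    by (auto simp: early_def dest: finite_imageD)
  have joints: "?Q \<subseteq> joints \<tau> \<delta>" "?R \<subseteq> joints \<tau> \<delta>"
    by (auto simp: early_joints_def)
  have dj: "A = B \<or> A \<inter> B = {}" if "A \<in> joints \<tau> \<delta>" "B \<in> joints \<tau> \<delta>" for A B
    using quotient_disj[OF equiv_same_edge that] .
  have "(\<Sum>a\<in>early \<tau> \<delta> s. \<Sum>b\<in>early \<tau> \<delta> s' - early \<tau> \<delta> s. mult ?G a b)
      \<le> (\<Sum>a\<in>Some ` ?Q. \<Sum>b\<in>Some ` ?R. mult ?G a b)"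
  proof (rule sum_disjoint_subset_le)
    fix a b assume a: "a \<in> early \<tau> \<delta> s" and b: "b \<in> early \<tau> \<delta> s' - early \<tau> \<delta> s" and pos: "mult ?G a b > 0"
    obtain B where B: "b = Some B" "B \<in> early_joints \<tau> \<delta> s'" "B \<notin> ?Q" "B \<noteq> root_boundary \<tau> \<delta>"
      using b by (auto simp: early_def)
    obtain A where A: "a = Some A"
      using pos B by (cases a) auto
    have "A \<in> joints \<tau> \<delta>"
      using pos by (auto simp: A B(1) elim: mult_identify_pos)
    then have "A \<in> ?Q"
      using a Some_early_iff[OF s] A by simp
    with A B show "a \<in> Some ` ?Q \<and> b \<in> Some ` ?R"
      by simp
  qed (use finite_early[OF fin bush(1)] finite_early[OF fin bush(2)] Q R in auto)
  also have "\<dots> = (\<Sum>A\<in>?Q. \<Sum>B\<in>?R. \<Sum>p\<in>A. \<Sum>q\<in>B. mult (pieces \<tau> \<delta>) p q)"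
    using joints by (simp add: sum.reindex) (auto simp: identify_def intro!: sum.cong)
  also have "\<dots> = (\<Sum>p\<in>\<Union>?Q. \<Sum>q\<in>\<Union>?R. mult (pieces \<tau> \<delta>) p q)"
  proof -
    have "(\<Sum>p\<in>\<Union>U. f p) = (\<Sum>A\<in>U. \<Sum>p\<in>A. f p)" if "U \<subseteq> joints \<tau> \<delta>" for U and f :: "_ \<Rightarrow> nat"
    proof (subst sum.Union_disjoint)
      show "\<forall>A\<in>U. finite A"
        using that finite_joint[OF fin] by blast
      show "\<forall>A\<in>U. \<forall>B\<in>U. A \<noteq> B \<longrightarrow> A \<inter> B = {}"
        using that dj by blast
    qed simp
    from this[OF joints(1)] this[OF joints(2)] show ?thesis
      by (simp add: sum.swap[of _ ?R])
  qed
  also have "\<dots> \<le> (\<Sum>p\<in>Pair s ` ?V. \<Sum>q\<in>Pair s ` ?V. mult (pieces \<tau> \<delta>) p q)"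
  proof (rule sum_disjoint_subset_le)
    fix p q assume "p \<in> \<Union>?Q" "q \<in> \<Union>?R" and pos: "mult (pieces \<tau> \<delta>) p q > 0"
    then have "fst p = s" "fst q = s"
      using crossing_edge[of _ \<tau> \<delta> s _ p q] joints by blast+
    then have "mult (inserted \<tau> \<delta> s) (snd p) (snd q) > 0"
      using pos by (cases p; cases q) (auto simp: mult_pieces split: if_splits)
    then have "snd p \<in> ?V" "snd q \<in> ?V"
      using wf by (auto simp: wf_mgraph_def)
    with \<open>fst p = s\<close> \<open>fst q = s\<close> show "p \<in> Pair s ` ?V \<and> q \<in> Pair s ` ?V"
      by (auto simp: image_iff prod_eq_iff)
  qed (use Q R joints finite_joint[OF fin] fin in auto)
  also have "\<dots> \<le> (\<Sum>x\<in>?V. \<Sum>y\<in>?V. mult (inserted \<tau> \<delta> s) x y)"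
    by (auto simp: sum.reindex inj_on_def mult_pieces intro!: sum_mono)
  finally show ?thesis .
qed

lemma mult_decorated_tree_sym:
  assumes wf: "\<And>u. wf_mgraph (inserted \<tau> \<delta> u)"
  shows "mult (decorated_tree \<tau> \<delta>) a b = mult (decorated_tree \<tau> \<delta>) b a"
proof (cases a; cases b)
  fix A B assume ab: "a = Some A" "b = Some B"
  have "mult (pieces \<tau> \<delta>) p q = mult (pieces \<tau> \<delta>) q p" for p q
    using wf by (cases p; cases q) (auto simp: mult_pieces wf_mgraph_def)
  then have "(\<Sum>p\<in>A. \<Sum>q\<in>B. mult (pieces \<tau> \<delta>) p q) = (\<Sum>q\<in>B. \<Sum>p\<in>A. mult (pieces \<tau> \<delta>) q p)"
    by (subst sum.swap) simp
  then show ?thesis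
    by (auto simp: ab identify_def)
qed auto

text \<open>
  The deterministic part: each index \<open>i \<noteq> 0\<close> for which the volume of \<open>G(s\<^sub>i)\<close> is at most \<open>M\<close> yields a cut, and
  infinitely many of these indices suffice. The index 0 is excluded because the root of the graph
  is attached to \<open>G(s\<^sub>0)\<close> itself.
\<close>

theorem recurrent_decorated_tree:
  fixes M :: nat
  assumes wf: "\<And>u. wf_mgraph (inserted \<tau> \<delta> u)"
    and fin: "\<And>u. finite (verts (inserted \<tau> \<delta> u))"
    and bush: "\<And>u. \<exists>n. \<not> reaches \<tau> n u"
    and inf: "\<exists>\<^sub>\<infinity>i. (\<Sum>x\<in>verts (inserted \<tau> \<delta> (spine \<tau> i)). \<Sum>y\<in>verts (inserted \<tau> \<delta> (spine \<tau> i)).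
        mult (inserted \<tau> \<delta> (spine \<tau> i)) x y) \<le> M"
  shows "recurrent (decorated_tree \<tau> \<delta>) dec_root"
proof -
  define I where "I = {i. i \<noteq> 0 \<and> (\<Sum>x\<in>verts (inserted \<tau> \<delta> (spine \<tau> i)). \<Sum>y\<in>verts (inserted \<tau> \<delta> (spine \<tau> i)).
        mult (inserted \<tau> \<delta> (spine \<tau> i)) x y) \<le> M}"
  have "infinite {i. (\<Sum>x\<in>verts (inserted \<tau> \<delta> (spine \<tau> i)). \<Sum>y\<in>verts (inserted \<tau> \<delta> (spine \<tau> i)).
        mult (inserted \<tau> \<delta> (spine \<tau> i)) x y) \<le> M}" (is "infinite ?J")
    using inf by (simp add: frequently_cofinite)
  moreover have "I = ?J - {0}"
    by (auto simp: I_def)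
  ultimately have "infinite I"
    by simp
  then obtain r :: "nat \<Rightarrow> nat" where r: "strict_mono r" "\<forall>k. r k \<in> I"
    using infinite_enumerate[of I] by blast
  define s where "s k = spine \<tau> (r k)" for k
  have s: "s k \<noteq> []" "strict_prefix (s k) (s (Suc k))" for k
  proof -
    have "length (s k) \<noteq> 0"
      using r(2)[rule_format, of k] by (simp add: s_def I_def)
    then show "s k \<noteq> []" by auto
    show "strict_prefix (s k) (s (Suc k))"
      unfolding s_def using r(1) by (intro strict_prefix_spine) (simp add: strict_mono_Suc_iff)
  qed
  have fin_s: "finite {w \<in> tree \<tau>. \<not> prefix (s k) w}" for k
    unfolding s_def using bush by (rule finite_not_below_spine)
  show ?thesis
  proof (rule recurrent_if_bounded_cuts[where S = "\<lambda>k. early \<tau> \<delta> (s k)" and M = "real M"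
        and w = "Some (root_boundary \<tau> \<delta>)"])
    fix k
    have "(\<Sum>a\<in>early \<tau> \<delta> (s k). \<Sum>b\<in>early \<tau> \<delta> (s (Suc k)) - early \<tau> \<delta> (s k). mult (decorated_tree \<tau> \<delta>) a b)
        \<le> (\<Sum>x\<in>verts (inserted \<tau> \<delta> (s k)). \<Sum>y\<in>verts (inserted \<tau> \<delta> (s k)). mult (inserted \<tau> \<delta> (s k)) x y)"
      by (rule cut_le[OF fin wf fin_s fin_s s(1)])
    also have "\<dots> \<le> M"
      using r(2)[rule_format, of k] by (simp add: s_def I_def)
    finally show "(\<Sum>a\<in>early \<tau> \<delta> (s k). \<Sum>b\<in>early \<tau> \<delta> (s (Suc k)) - early \<tau> \<delta> (s k).
        real (mult (decorated_tree \<tau> \<delta>) a b)) \<le> real M"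
      by (simp flip: of_nat_sum)
  next
    fix k a b
    assume "a \<in> early \<tau> \<delta> (s k)" "mult (decorated_tree \<tau> \<delta>) a b > 0"
    then show "b \<in> early \<tau> \<delta> (s (Suc k))"
      by (rule early_neighbours[OF s])
  next
    show "early \<tau> \<delta> (s k) \<subseteq> early \<tau> \<delta> (s (Suc k))" for k
      using s(2) by (intro early_mono) (simp add: strict_prefix_def)
  next
    show "finite (early \<tau> \<delta> (s k))" for k
      by (rule finite_early[OF fin fin_s])
  next
    show "mult (decorated_tree \<tau> \<delta>) a b = mult (decorated_tree \<tau> \<delta>) b a" for a b
      by (rule mult_decorated_tree_sym[OF wf])
  qed (simp_all add: dec_root_def early_def)
qed

section \<open>Independence and critical branching\<close>

lemma indep_vars_PiM_pmf:
  "prob_space.indep_vars (PiM UNIV (\<lambda>_::'i. measure_pmf p)) (\<lambda>_. measure_pmf p) (\<lambda>i \<omega>. \<omega> i) UNIV"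
proof -
  interpret product_prob_space "\<lambda>_::'i. measure_pmf p" UNIV
    by unfold_locales
  have "distr (PiM UNIV (\<lambda>_::'i. measure_pmf p)) (PiM UNIV (\<lambda>_. measure_pmf p)) (\<lambda>\<omega>. \<lambda>i\<in>UNIV. \<omega> i)
      = PiM UNIV (\<lambda>_::'i. measure_pmf p)"
    by (simp add: restrict_def distr_id2)
  moreover have "distr (PiM UNIV (\<lambda>_::'i. measure_pmf p)) (measure_pmf p) (\<lambda>\<omega>. \<omega> i) = measure_pmf p" for i
    by (rule PiM_component) simp
  ultimately show ?thesis
    by (subst indep_vars_iff_distr_eq_PiM) auto
qed

text \<open>
  One implication is enough because \<open>\<omega>\<close> and \<open>\<omega>'\<close> can be exchanged.
\<close>

definition determined_below :: "nat list \<Rightarrow> (nat list \<Rightarrow> 'a) set \<Rightarrow> bool" where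
  "determined_below u E \<longleftrightarrow>
     (\<forall>\<omega> \<omega>'. (\<forall>w. prefix u w \<longrightarrow> \<omega> w = \<omega>' w) \<longrightarrow> \<omega> \<in> E \<longrightarrow> \<omega>' \<in> E)"

text \<open>
  The words \<open>u\<close> and, for the different \<open>j\<close>, the words with prefix \<open>u @ [j]\<close> form disjoint sets, and
  the restrictions of an independent family to disjoint sets of indices are independent. To see an
  event determined below \<open>u @ [j]\<close> as an event of the restriction, the missing coordinates are filled
  with an arbitrary value.
\<close>

lemma measure_branching:
  fixes p :: "'a pmf" and E :: "nat \<Rightarrow> (nat list \<Rightarrow> 'a) set"
  defines "\<Omega> \<equiv> PiM UNIV (\<lambda>_::nat list. measure_pmf p)"
  assumes J: "finite J"
    and E: "\<And>j. j \<in> J \<Longrightarrow> E j \<in> sets \<Omega>" "\<And>j. j \<in> J \<Longrightarrow> determined_below (u @ [j]) (E j)"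
  shows "measure \<Omega> {\<omega>. \<omega> u \<in> X \<and> (\<forall>j\<in>J. \<omega> \<in> E j)} = measure_pmf.prob p X * (\<Prod>j\<in>J. measure \<Omega> (E j))"
proof -
  interpret product_prob_space "\<lambda>_::nat list. measure_pmf p" UNIV
    by unfold_locales
  have space: "space \<Omega> = UNIV"
    by (simp add: \<Omega>_def space_PiM)
  \<comment> \<open>The index \<open>None\<close> stands for the vertex \<open>u\<close> and \<open>Some j\<close> for what lies below its child \<open>j\<close>.\<close>
  define K where "K l = (case l of None \<Rightarrow> {u} | Some j \<Rightarrow> {w. prefix (u @ [j]) w})" for l
  let ?L = "insert None (Some ` J)"
  let ?P = "\<lambda>l. PiM (K l) (\<lambda>_. measure_pmf p)"
  have "disjoint_family_on K ?L"
    by (auto simp: disjoint_family_on_def K_def prefix_def split: option.splits)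
  then have ind: "indep_vars ?P (\<lambda>l \<omega>. restrict \<omega> (K l)) ?L"
    using indep_vars_restrict[OF indep_vars_PiM_pmf, of ?L K] by simp
  define ext :: "nat option \<Rightarrow> (nat list \<Rightarrow> 'a) \<Rightarrow> nat list \<Rightarrow> 'a"
    where "ext l \<eta> = (\<lambda>w. if w \<in> K l then \<eta> w else undefined)" for l \<eta>
  have ext: "ext l \<in> ?P l \<rightarrow>\<^sub>M \<Omega>" for l
    unfolding \<Omega>_def ext_def[abs_def]
  proof (rule measurable_abs_UNIV)
    fix w show "(\<lambda>\<eta>. if w \<in> K l then \<eta> w else undefined) \<in> ?P l \<rightarrow>\<^sub>M measure_pmf p"
      by (cases "w \<in> K l") (auto intro: measurable_component_singleton)
  qed
  define A where "A l = (case l of None \<Rightarrow> {\<eta> \<in> space (?P None). \<eta> u \<in> X}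
      | Some j \<Rightarrow> ext l -` E j \<inter> space (?P l))" for l
  have sets_A: "A l \<in> sets (?P l)" if "l \<in> ?L" for l
  proof (cases l)
    case None
    have "{\<eta> \<in> space (?P None). \<eta> u \<in> X} \<in> sets (?P None)"
      by (rule measurable_sets_Collect[OF measurable_component_singleton[where i = u]]) (auto simp: K_def)
    then show ?thesis
      by (simp add: None A_def)
  next
    case (Some j)
    then have "j \<in> J"
      using that by auto
    from measurable_sets[OF ext E(1)[OF this], of l] show ?thesis
      by (simp add: A_def Some)
  qed
  define B where "B l = (\<lambda>\<omega>. restrict \<omega> (K l)) -` A l \<inter> space \<Omega>" for l
  have prod: "prob (\<Inter>l\<in>?L. B l) = (\<Prod>l\<in>?L. prob (B l))"
    unfolding B_def \<Omega>_def using J by (intro indep_varsD_finite[OF ind] sets_A) auto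
  have A_None: "B None = {\<omega>. \<omega> u \<in> X}"
    by (auto simp: B_def A_def space space_PiM K_def)
  have A_Some: "B (Some j) = E j" if "j \<in> J" for j
  proof -
    have "ext (Some j) (restrict \<omega> (K (Some j))) \<in> E j \<longleftrightarrow> \<omega> \<in> E j" for \<omega>
      using E(2)[OF that, unfolded determined_below_def, rule_format,
          of \<omega> "ext (Some j) (restrict \<omega> (K (Some j)))"]
        E(2)[OF that, unfolded determined_below_def, rule_format,
          of "ext (Some j) (restrict \<omega> (K (Some j)))" \<omega>]
      by (auto simp: ext_def K_def)
    then show ?thesis
      by (auto simp: B_def A_def space space_PiM)
  qed
  have "prob {\<omega>. \<omega> u \<in> X} = measure_pmf.prob p X"
  proof -
    have "emeasure \<Omega> {\<omega> \<in> space \<Omega>. \<omega> u \<in> X} = emeasure (measure_pmf p) X"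
      unfolding \<Omega>_def by (rule emeasure_PiM_Collect_single) auto
    then show ?thesis
      by (simp add: space \<Omega>_def[symmetric] measure_def)
  qed
  moreover have "(\<Inter>l\<in>?L. B l) = {\<omega>. \<omega> u \<in> X \<and> (\<forall>j\<in>J. \<omega> \<in> E j)}"
    using A_None A_Some by auto
  moreover have "(\<Prod>l\<in>?L. prob (B l)) = prob (B None) * (\<Prod>j\<in>J. prob (B (Some j)))"
    using J by (simp add: prod.reindex)
  ultimately show ?thesis
    using prod A_None A_Some by (simp add: \<Omega>_def)
qed

lemma measure_sums_partition:
  fixes f :: "'a \<Rightarrow> nat"
  assumes "finite_measure M" "\<And>k. {x \<in> A. f x = k} \<in> sets M"
  shows "(\<lambda>k. measure M {x \<in> A. f x = k}) sums measure M A"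
proof -
  interpret finite_measure M by fact
  have "(\<lambda>k. measure M {x \<in> A. f x = k}) sums measure M (\<Union>k. {x \<in> A. f x = k})"
    using assms(2) by (intro finite_measure_UNION) (auto simp: disjoint_family_on_def)
  then show ?thesis
    by (simp add: UN_extend_simps Collect_bex_eq[symmetric])
qed

lemma pmf_nat_expectation_sums:
  fixes f :: "nat \<Rightarrow> real"
  assumes "integrable (measure_pmf p) f"
  shows "(\<lambda>k. pmf p k * f k) sums (\<integral>k. f k \<partial>measure_pmf p)"
proof -
  have "integrable (count_space UNIV) (\<lambda>k. pmf p k * f k)"
    using assms unfolding measure_pmf_eq_density by (subst (asm) integrable_density) auto
  moreover have "(\<integral>k. f k \<partial>measure_pmf p) = (\<integral>k. pmf p k * f k \<partial>count_space UNIV)"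
    unfolding measure_pmf_eq_density by (subst integral_density) auto
  ultimately show ?thesis
    using sums_integral_count_space_nat by metis
qed

text \<open>
  A fixed point \<open>r\<close> of the generating function \<open>f\<close> satisfies \<open>f r = 1 + (r - 1) * f' 1\<close>, as the mean
  \<open>f' 1\<close> is 1. By Bernoulli's inequality each \<open>r ^ k\<close> is at least \<open>1 + k * (r - 1)\<close>, so equality must
  hold for every \<open>k\<close> in the support, and for \<open>k \<ge> 2\<close> this forces \<open>r = 1\<close>.
\<close>

lemma critical_generating_fixed_point:
  fixes \<xi> :: "nat pmf" and r :: real
  assumes critical: "integrable (measure_pmf \<xi>) real" "measure_pmf.expectation \<xi> real = 1"
    and k: "k \<in> set_pmf \<xi>" "k \<ge> 2"
    and r: "0 \<le> r" "r \<le> 1" "(\<integral>k. r ^ k \<partial>measure_pmf \<xi>) = r"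
  shows "r = 1"
proof -
  have int: "integrable (measure_pmf \<xi>) (\<lambda>k. r ^ k)"
    using r by (intro measure_pmf.integrable_const_bound[where B = 1]) (auto simp: power_le_one)
  let ?h = "\<lambda>k. r ^ k - (1 + real k * (r - 1))"
  have nonneg: "0 \<le> ?h k" for k
    using Bernoulli_inequality[of "r - 1" k] r by simp
  have "integrable (measure_pmf \<xi>) ?h"
    using int critical(1) by auto
  moreover have "(\<integral>k. ?h k \<partial>measure_pmf \<xi>) = 0"
    using int critical r(3) by simp
  ultimately have "AE k in measure_pmf \<xi>. ?h k = 0"
    using nonneg by (subst (asm) integral_nonneg_eq_0_iff_AE) auto
  then have eq: "r ^ k = 1 + real k * (r - 1)"
    using k(1) by (simp add: AE_measure_pmf_iff)
  obtain m where m: "k = Suc (Suc m)"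
    using k(2) by (metis add_2_eq_Suc le_Suc_ex)
  have "r * (1 + real (Suc m) * (r - 1)) \<le> r * r ^ Suc m"
    using Bernoulli_inequality[of "r - 1" "Suc m"] r by (intro mult_left_mono) auto
  also have "\<dots> = 1 + real k * (r - 1)"
    using eq by (simp add: m)
  finally have "real (Suc m) * (r - 1)\<^sup>2 \<le> 0"
    by (simp add: m power2_eq_square algebra_simps)
  then have "(r - 1)\<^sup>2 \<le> 0"
    by (simp add: mult_le_0_iff del: of_nat_Suc)
  then show "r = 1"
    by simp
qed

section \<open>Extinction off the backbone and degrees along it\<close>

lemma prob_space_kesten: "prob_space (kesten \<xi>)"
  unfolding kesten_def by (intro prob_space_PiM measure_pmf.prob_space_axioms)

lemma space_kesten [simp]: "space (kesten \<xi>) = UNIV"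
  by (simp add: kesten_def space_PiM)

lemma sets_kesten_coordinate: "{\<tau>. P (\<tau> u)} \<in> sets (kesten \<xi>)"
  unfolding kesten_def
  using measurable_sets_Collect[OF measurable_component_singleton, of u UNIV "\<lambda>_. measure_pmf (individual_pmf \<xi>)" P]
  by (simp add: space_PiM)

lemma sets_reaches: "{\<tau>. reaches \<tau> n u} \<in> sets (kesten \<xi>)"
proof (induction n arbitrary: u)
  case 0
  then show ?case using sets.top[of "kesten \<xi>"] by simp
next
  case (Suc n)
  have "{\<tau>. reaches \<tau> (Suc n) u} = (\<Union>k. {\<tau>. fst (\<tau> u) = k} \<inter> (\<Union>j\<in>{1..k}. {\<tau>. reaches \<tau> n (u @ [j])}))"
    by auto
  then show ?case
    using Suc sets_kesten_coordinate[of "\<lambda>t. fst t = _" u \<xi>] by (auto intro!: sets.countable_UN' sets.Int sets.finite_UN)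
qed

lemma reaches_cong:
  "(\<And>w. prefix u w \<Longrightarrow> \<tau> w = \<tau>' w) \<Longrightarrow> reaches \<tau> n u = reaches \<tau>' n u"
proof (induction n arbitrary: u)
  case (Suc n)
  have "reaches \<tau> n (u @ [j]) = reaches \<tau>' n (u @ [j])" for j
    by (rule Suc.IH) (use Suc.prems append_prefixD in blast)
  then show ?case
    using Suc.prems[of u] by simp
qed simp

lemma map_fst_individual_pmf: "map_pmf fst (individual_pmf \<xi>) = \<xi>"
  by (simp add: individual_pmf_def map_fst_pair_pmf)

lemma map_snd_individual_pmf: "map_pmf (\<lambda>t. fst (snd t)) (individual_pmf \<xi>) = size_biased \<xi>"
proof -
  have "map_pmf (\<lambda>t. fst (snd t)) (individual_pmf \<xi>) = map_pmf fst (map_pmf snd (individual_pmf \<xi>))"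
    by (simp add: map_pmf_comp)
  then show ?thesis
    by (simp add: individual_pmf_def map_snd_pair_pmf map_bind_pmf map_pmf_comp map_pmf_const bind_return_pmf')
qed

text \<open>
  The iterates at 0 of the generating function of \<open>\<xi>\<close>.
\<close>

primrec dies_by :: "nat pmf \<Rightarrow> nat \<Rightarrow> real" where
  "dies_by \<xi> 0 = 0"
| "dies_by \<xi> (Suc n) = (\<integral>k. dies_by \<xi> n ^ k \<partial>measure_pmf \<xi>)"

lemma dies_by_bounds: "0 \<le> dies_by \<xi> n" "dies_by \<xi> n \<le> 1"
proof (induction n)
  case (Suc n)
  show "dies_by \<xi> (Suc n) \<le> 1"
    using Suc by (auto intro!: measure_pmf.integral_le_const measure_pmf.integrable_const_bound[where B = 1] simp: power_le_one)
  show "0 \<le> dies_by \<xi> (Suc n)"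
    using Suc by auto
qed auto

text \<open>
  Given that \<open>u\<close> has \<open>k\<close> children, the line of \<open>u\<close> dies within \<open>n + 1\<close> generations iff the \<open>k\<close>
  independent lines of its children die within \<open>n\<close>; summing over \<open>k\<close> gives the generating function.
\<close>

lemma measure_not_reaches: "measure (kesten \<xi>) {\<tau>. \<not> reaches \<tau> n u} = dies_by \<xi> n"
proof (induction n arbitrary: u)
  case (Suc n)
  interpret prob_space "kesten \<xi>" by (rule prob_space_kesten)
  let ?E = "\<lambda>j. {\<tau>. \<not> reaches \<tau> n (u @ [j])}"
  have E: "{\<tau>. \<not> reaches \<tau> m w} \<in> sets (kesten \<xi>)" for m w
    using sets.compl_sets[OF sets_reaches[of m w \<xi>]] by (simp add: Collect_neg_eq Compl_eq_Diff_UNIV)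
  have det: "determined_below (u @ [j]) (?E j)" for j
    unfolding determined_below_def
  proof (intro allI impI)
    fix \<omega> \<omega>' :: genealogy
    assume "\<forall>w. prefix (u @ [j]) w \<longrightarrow> \<omega> w = \<omega>' w" "\<omega> \<in> ?E j"
    then show "\<omega>' \<in> ?E j"
      using reaches_cong[of "u @ [j]" \<omega> \<omega>' n] by simp
  qed
  have part: "{\<tau> \<in> {\<tau>. \<not> reaches \<tau> (Suc n) u}. fst (\<tau> u) = k} = {\<tau>. \<tau> u \<in> {t. fst t = k} \<and> (\<forall>j\<in>{1..k}. \<tau> \<in> ?E j)}" for k
    by auto
  have meas: "measure (kesten \<xi>) {\<tau>. \<tau> u \<in> {t. fst t = k} \<and> (\<forall>j\<in>{1..k}. \<tau> \<in> ?E j)} = pmf \<xi> k * dies_by \<xi> n ^ k" for k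
  proof -
    have "measure_pmf.prob (individual_pmf \<xi>) {t. fst t = k} = pmf (map_pmf fst (individual_pmf \<xi>)) k"
      by (simp add: pmf_map vimage_def)
    then show ?thesis
      using measure_branching[of "{1..k}" ?E "individual_pmf \<xi>" u "{t. fst t = k}"] E det
      by (simp add: kesten_def[symmetric] map_fst_individual_pmf Suc.IH)
  qed
  have "{\<tau> \<in> {\<tau>. \<not> reaches \<tau> (Suc n) u}. fst (\<tau> u) = k} \<in> sets (kesten \<xi>)" for k
    using sets.Int[OF E[of "Suc n" u] sets_kesten_coordinate[of "\<lambda>t. fst t = k" u \<xi>]]
    by (simp add: Collect_conj_eq del: reaches.simps)
  from measure_sums_partition[OF finite_measure_axioms this]
  have "(\<lambda>k. pmf \<xi> k * dies_by \<xi> n ^ k) sums measure (kesten \<xi>) {\<tau>. \<not> reaches \<tau> (Suc n) u}"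
    unfolding part meas .
  moreover have "(\<lambda>k. pmf \<xi> k * dies_by \<xi> n ^ k) sums dies_by \<xi> (Suc n)"
    using pmf_nat_expectation_sums[of \<xi> "\<lambda>k. dies_by \<xi> n ^ k"] dies_by_bounds[of \<xi> n]
    by (simp add: measure_pmf.integrable_const_bound[where B = 1] power_le_one)
  ultimately show ?case
    using sums_unique2 by blast
qed simp

lemma dies_by_tendsto_1:
  assumes critical: "integrable (measure_pmf \<xi>) real" "measure_pmf.expectation \<xi> real = 1"
    and k: "k \<in> set_pmf \<xi>" "k \<ge> 2"
  shows "dies_by \<xi> \<longlonglongrightarrow> 1"
proof -
  have int: "integrable (measure_pmf \<xi>) (\<lambda>k. dies_by \<xi> n ^ k)" for n
    using dies_by_bounds[of \<xi> n] by (auto intro!: measure_pmf.integrable_const_bound[where B = 1] simp: power_le_one)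
  have "incseq (dies_by \<xi>)"
  proof (rule incseq_SucI)
    fix n show "dies_by \<xi> n \<le> dies_by \<xi> (Suc n)"
    proof (induction n)
      case (Suc n)
      have "(\<integral>k. dies_by \<xi> n ^ k \<partial>measure_pmf \<xi>) \<le> (\<integral>k. dies_by \<xi> (Suc n) ^ k \<partial>measure_pmf \<xi>)"
        by (intro integral_mono int power_mono Suc dies_by_bounds)
      then show ?case by simp
    qed (use dies_by_bounds in auto)
  qed
  then obtain r where r: "dies_by \<xi> \<longlonglongrightarrow> r"
    using incseq_convergent[of "dies_by \<xi>" 1] dies_by_bounds by metis
  have "0 \<le> r" "r \<le> 1"
    using LIMSEQ_le_const[OF r, of 0] LIMSEQ_le_const2[OF r, of 1] dies_by_bounds[of \<xi>] by auto
  moreover have "(\<integral>k. r ^ k \<partial>measure_pmf \<xi>) = r"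
  proof -
    have "(\<lambda>n. \<integral>k. dies_by \<xi> n ^ k \<partial>measure_pmf \<xi>) \<longlonglongrightarrow> (\<integral>k. r ^ k \<partial>measure_pmf \<xi>)"
      using dies_by_bounds[of \<xi>]
      by (intro integral_dominated_convergence[where w = "\<lambda>_. 1"] AE_I2 tendsto_power r) (auto simp: power_le_one)
    moreover have "(\<lambda>n. dies_by \<xi> (Suc n)) \<longlonglongrightarrow> r"
      by (rule LIMSEQ_Suc[OF r])
    ultimately show ?thesis
      using LIMSEQ_unique by simp
  qed
  ultimately have "r = 1"
    using critical_generating_fixed_point[OF critical k] by blast
  with r show ?thesis by simp
qed

lemma AE_kesten_extinction:
  assumes "integrable (measure_pmf \<xi>) real" "measure_pmf.expectation \<xi> real = 1"
    and "k \<in> set_pmf \<xi>" "k \<ge> 2"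
  shows "AE \<tau> in kesten \<xi>. \<forall>u. \<exists>n. \<not> reaches \<tau> n u"
proof -
  interpret prob_space "kesten \<xi>" by (rule prob_space_kesten)
  have "AE \<tau> in kesten \<xi>. \<exists>n. \<not> reaches \<tau> n u" for u
  proof -
    let ?A = "\<Inter>n. {\<tau>. reaches \<tau> n u}"
    have A: "?A \<in> sets (kesten \<xi>)"
      using sets_reaches by auto
    have "prob ?A \<le> 1 - dies_by \<xi> n" for n
    proof -
      have "prob ?A \<le> prob {\<tau>. reaches \<tau> n u}"
        by (intro finite_measure_mono sets_reaches) auto
      also have "\<dots> = 1 - dies_by \<xi> n"
        using prob_compl[OF sets_reaches[of n u \<xi>]] measure_not_reaches[of \<xi> n u]
        by (simp add: Collect_neg_eq Compl_eq_Diff_UNIV)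
      finally show ?thesis .
    qed
    moreover have "(\<lambda>n. 1 - dies_by \<xi> n) \<longlonglongrightarrow> 1 - 1"
      by (intro tendsto_intros dies_by_tendsto_1[OF assms])
    ultimately have "prob ?A \<le> 0"
      using LIMSEQ_le_const by fastforce
    then have "prob ?A = 0"
      using measure_nonneg[of "kesten \<xi>" ?A] by linarith
    then show ?thesis
      using A by (intro AE_I[where N = ?A]) (auto simp: emeasure_eq_measure)
  qed
  then show ?thesis
    by (simp add: AE_all_countable)
qed

text \<open>
  On the line that starts at \<open>u\<close> and always continues with the special child, none of the first \<open>n\<close>
  individuals has \<open>b\<close> children; all of them are treated as special. Defining this for every word \<open>u\<close>,
  and not only along the random backbone, gives an event that is determined below \<open>u\<close>.
\<close>

primrec misses :: "nat \<Rightarrow> genealogy \<Rightarrow> nat \<Rightarrow> nat list \<Rightarrow> bool" where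
  "misses b \<tau> 0 u \<longleftrightarrow> True"
| "misses b \<tau> (Suc n) u \<longleftrightarrow> fst (snd (\<tau> u)) \<noteq> b \<and> misses b \<tau> n (u @ [snd (snd (\<tau> u))])"

lemma sets_misses: "{\<tau>. misses b \<tau> n u} \<in> sets (kesten \<xi>)"
proof (induction n arbitrary: u)
  case 0
  then show ?case using sets.top[of "kesten \<xi>"] by simp
next
  case (Suc n)
  have "{\<tau>. misses b \<tau> (Suc n) u} =
      (\<Union>j. {\<tau>. fst (snd (\<tau> u)) \<noteq> b \<and> snd (snd (\<tau> u)) = j} \<inter> {\<tau>. misses b \<tau> n (u @ [j])})"
    by auto
  then show ?case
    using Suc sets_kesten_coordinate[of "\<lambda>t. fst (snd t) \<noteq> b \<and> snd (snd t) = _" u \<xi>]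
    by (auto intro!: sets.countable_UN' sets.Int)
qed

lemma misses_cong:
  "(\<And>w. prefix u w \<Longrightarrow> \<tau> w = \<tau>' w) \<Longrightarrow> misses b \<tau> n u = misses b \<tau>' n u"
proof (induction n arbitrary: u)
  case (Suc n)
  have "misses b \<tau> n (u @ [j]) = misses b \<tau>' n (u @ [j])" for j
    by (rule Suc.IH) (use Suc.prems append_prefixD in blast)
  then show ?case
    using Suc.prems[of u] by simp
qed simp

text \<open>
  The numbers of children on the line are independent with the size-biased law. The proof splits
  according to which child of \<open>u\<close> is the special one.
\<close>

lemma measure_misses: "measure (kesten \<xi>) {\<tau>. misses b \<tau> n u} = (1 - pmf (size_biased \<xi>) b) ^ n"
proof (induction n arbitrary: u)
  case 0
  interpret prob_space "kesten \<xi>" by (rule prob_space_kesten)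
  show ?case using prob_space by simp
next
  case (Suc n)
  interpret prob_space "kesten \<xi>" by (rule prob_space_kesten)
  let ?q = "1 - pmf (size_biased \<xi>) b"
  let ?B = "{t. fst (snd t) \<noteq> b} :: (nat \<times> nat \<times> nat) set"
  let ?E = "\<lambda>j. {\<tau>. misses b \<tau> n (u @ [j])}"
  have det: "determined_below (u @ [j]) (?E j)" for j
    unfolding determined_below_def
  proof (intro allI impI)
    fix \<omega> \<omega>' :: genealogy
    assume "\<forall>w. prefix (u @ [j]) w \<longrightarrow> \<omega> w = \<omega>' w" "\<omega> \<in> ?E j"
    then show "\<omega>' \<in> ?E j"
      using misses_cong[of "u @ [j]" \<omega> \<omega>' b n] by simp
  qed
  have part: "{\<tau> \<in> {\<tau>. misses b \<tau> (Suc n) u}. snd (snd (\<tau> u)) = j} =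
      {\<tau>. \<tau> u \<in> {t \<in> ?B. snd (snd t) = j} \<and> (\<forall>j\<in>{j}. \<tau> \<in> ?E j)}" for j
    by auto
  have meas: "measure (kesten \<xi>) {\<tau>. \<tau> u \<in> {t \<in> ?B. snd (snd t) = j} \<and> (\<forall>j\<in>{j}. \<tau> \<in> ?E j)}
      = measure_pmf.prob (individual_pmf \<xi>) {t \<in> ?B. snd (snd t) = j} * ?q ^ n" for j
    using measure_branching[of "{j}" ?E "individual_pmf \<xi>" u "{t \<in> ?B. snd (snd t) = j}"] sets_misses det
    by (simp add: kesten_def[symmetric] Suc.IH)
  have "{\<tau> \<in> {\<tau>. misses b \<tau> (Suc n) u}. snd (snd (\<tau> u)) = j} \<in> sets (kesten \<xi>)" for j
    using sets.Int[OF sets_misses[of b "Suc n" u \<xi>] sets_kesten_coordinate[of "\<lambda>t. snd (snd t) = j" u \<xi>]]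
    by (simp add: Collect_conj_eq del: misses.simps)
  from measure_sums_partition[OF finite_measure_axioms this]
  have "(\<lambda>j. measure_pmf.prob (individual_pmf \<xi>) {t \<in> ?B. snd (snd t) = j} * ?q ^ n)
      sums measure (kesten \<xi>) {\<tau>. misses b \<tau> (Suc n) u}"
    unfolding part meas .
  moreover have "(\<lambda>j. measure_pmf.prob (individual_pmf \<xi>) {t \<in> ?B. snd (snd t) = j} * ?q ^ n)
      sums (measure_pmf.prob (individual_pmf \<xi>) ?B * ?q ^ n)"
    by (intro sums_mult2 measure_sums_partition measure_pmf.finite_measure_axioms) auto
  moreover have "measure_pmf.prob (individual_pmf \<xi>) ?B = ?q"
  proof -
    have "measure_pmf.prob (individual_pmf \<xi>) ?B = measure_pmf.prob (size_biased \<xi>) (- {b})"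
      unfolding map_snd_individual_pmf[symmetric] by (simp add: vimage_def Compl_eq)
    also have "\<dots> = ?q"
      using measure_pmf.prob_compl[of "{b}" "size_biased \<xi>"] by (simp add: Compl_eq_Diff_UNIV measure_pmf_single)
    finally show ?thesis .
  qed
  ultimately show ?case
    using sums_unique2 by fastforce
qed

lemma misses_spine: "(\<And>i. i \<ge> m \<Longrightarrow> fst (snd (\<tau> (spine \<tau> i))) \<noteq> b) \<Longrightarrow> misses b \<tau> n (spine \<tau> m)"
proof (induction n arbitrary: m)
  case (Suc n)
  from Suc.IH[of "Suc m"] Suc.prems show ?case
    by simp
qed simp

text \<open>
  By \<open>measure_misses\<close> there is almost surely no word, in particular no backbone vertex, from which
  \<open>b\<close> is missed for ever.
\<close>

lemma AE_kesten_spine_infinitely_often: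
  assumes "pmf (size_biased \<xi>) b > 0"
  shows "AE \<tau> in kesten \<xi>. \<exists>\<^sub>\<infinity>i. fst (snd (\<tau> (spine \<tau> i))) = b"
proof -
  interpret prob_space "kesten \<xi>" by (rule prob_space_kesten)
  let ?q = "1 - pmf (size_biased \<xi>) b"
  have "AE \<tau> in kesten \<xi>. \<exists>n. \<not> misses b \<tau> n u" for u
  proof -
    let ?A = "\<Inter>n. {\<tau>. misses b \<tau> n u}"
    have A: "?A \<in> sets (kesten \<xi>)"
      using sets_misses by auto
    have "prob ?A \<le> ?q ^ n" for n
      unfolding measure_misses[symmetric, of \<xi> b n u]
      by (intro finite_measure_mono sets_misses) auto
    moreover have "(\<lambda>n. ?q ^ n) \<longlonglongrightarrow> 0"
      using assms by (intro LIMSEQ_realpow_zero) (auto simp: pmf_le_1)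
    ultimately have "prob ?A \<le> 0"
      using LIMSEQ_le_const by fastforce
    then have "prob ?A = 0"
      using measure_nonneg[of "kesten \<xi>" ?A] by linarith
    then show ?thesis
      using A by (intro AE_I[where N = ?A]) (auto simp: emeasure_eq_measure)
  qed
  then have "AE \<tau> in kesten \<xi>. \<forall>u. \<exists>n. \<not> misses b \<tau> n u"
    by (simp add: AE_all_countable)
  then show ?thesis
  proof eventually_elim
    fix \<tau> assume *: "\<forall>u. \<exists>n. \<not> misses b \<tau> n u"
    show "\<exists>\<^sub>\<infinity>i. fst (snd (\<tau> (spine \<tau> i))) = b"
      unfolding INFM_nat_le
    proof (intro allI)
      fix m
      obtain n where "\<not> misses b \<tau> n (spine \<tau> m)"
        using * by blast
      then show "\<exists>i\<ge>m. fst (snd (\<tau> (spine \<tau> i))) = b"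
        using misses_spine[of m \<tau> b n] by blast
    qed
  qed
qed

section \<open>Volumes of the inserted graphs\<close>

lemma total_volume_eq:
  "total_volume g = (\<integral>\<^sup>+x. (\<integral>\<^sup>+y. of_nat (mult g x y) \<partial>count_space UNIV) * indicator (verts g) x \<partial>count_space UNIV)"
proof -
  have "total_volume g = (\<integral>\<^sup>+x. degree g x * indicator (verts g) x \<partial>count_space (verts g))"
    unfolding total_volume_def degree_measure_def point_measure_def
    by (subst emeasure_density) auto
  also have "\<dots> = (\<integral>\<^sup>+x. degree g x \<partial>count_space (verts g))"
    by (intro nn_integral_cong) simp
  also have "\<dots> = (\<integral>\<^sup>+x. degree g x * indicator (verts g) x \<partial>count_space UNIV)"
    by (rule nn_integral_count_space_indicator) (simp add: NO_MATCH_def)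
  finally show ?thesis
    by (simp add: degree_def)
qed

lemma space_dgraph_space [simp]: "space dgraph_space = UNIV"
  by (simp add: dgraph_space_def)

text \<open>
  Measurability is what gives the tail bound on the volume its content, since
  \<^const>\<open>prob_graph\<close> takes the value 0 on sets that are not measurable.
\<close>

lemma measurable_total_volume: "total_volume \<in> borel_measurable dgraph_space"
proof -
  have V: "{g. x \<in> verts g} \<in> sets dgraph_space" for x :: nat
    unfolding dgraph_space_def by (rule in_measure_of) (simp, blast)
  have m: "{g. mult g x y = k} \<in> sets dgraph_space" for x y :: nat and k
    unfolding dgraph_space_def by (rule in_measure_of) (simp, blast)
  have "(\<lambda>g. mult g x y) \<in> dgraph_space \<rightarrow>\<^sub>M count_space UNIV" for x y :: nat
    by (subst measurable_count_space_eq2_countable) (auto simp: vimage_def m)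
  then have mult: "(\<lambda>g. of_nat (mult g x y) :: ennreal) \<in> borel_measurable dgraph_space" for x y :: nat
    by (rule measurable_compose) simp
  have ind: "(\<lambda>g. indicator (verts g) x :: ennreal) \<in> borel_measurable dgraph_space" for x :: nat
  proof -
    have "(\<lambda>g. indicator {g. x \<in> verts g} g :: ennreal) \<in> borel_measurable dgraph_space"
      using V by simp
    then show ?thesis
      by (simp add: indicator_def)
  qed
  have "(\<lambda>g. \<Sum>x. (\<Sum>y. of_nat (mult g x y)) * indicator (verts g) x :: ennreal) \<in> borel_measurable dgraph_space"
    by (intro borel_measurable_suminf_order borel_measurable_times_ennreal mult ind)
  then show ?thesis
    by (simp add: total_volume_eq[abs_def] nn_integral_count_space_nat)
qed

text \<open>
  In a connected graph with at least two vertices every degree is at least 1, so an infinite graph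
  has infinite volume.
\<close>

lemma finite_graph_if_finite_volume:
  fixes g :: "'v dgraph"
  assumes g: "is_inserted_graph n g" and vol: "total_volume g < \<infinity>"
  shows "finite (verts g)"
proof -
  have wf: "wf_mgraph g" and conn: "connected_mgraph g"
    using g by (auto simp: is_inserted_graph_def)
  have one: "1 \<le> degree g x" if x: "x \<in> verts g" and y: "y \<in> verts g" "x \<noteq> y" for x y
  proof -
    have "(x, y) \<in> {(a, b). mult g a b > 0}\<^sup>*"
      using conn x y by (auto simp: connected_mgraph_def)
    then obtain z where z: "mult g x z > 0"
      using y by (auto elim: converse_rtranclE)
    have "(1::ennreal) \<le> of_nat (mult g x z)"
      using z by (cases "mult g x z") auto
    also have "\<dots> = (\<integral>\<^sup>+y. of_nat (mult g x z) * indicator {z} y \<partial>count_space UNIV)"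
      by simp
    also have "\<dots> \<le> degree g x"
      unfolding degree_def by (intro nn_integral_mono) (auto split: split_indicator)
    finally show ?thesis .
  qed
  show ?thesis
  proof (rule ccontr)
    assume inf: "infinite (verts g)"
    have "1 \<le> degree g x" if x: "x \<in> verts g" for x
    proof -
      have "infinite (verts g - {x})" using inf by simp
      then obtain y where "y \<in> verts g - {x}" by (metis finite.emptyI ex_in_conv)
      then show ?thesis using one[OF x, of y] by auto
    qed
    then have "(\<integral>\<^sup>+x. indicator (verts g) x \<partial>count_space UNIV) \<le> total_volume g"
      unfolding total_volume_eq degree_def[symmetric] by (intro nn_integral_mono) (auto split: split_indicator)
    then have "emeasure (count_space UNIV) (verts g) \<le> total_volume g"
      by simp
    then show False
      using inf vol by simp
  qed
qed

lemma sum_mult_le_total_volume: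
  fixes g :: "'v dgraph"
  assumes "finite (verts g)"
  shows "of_nat (\<Sum>x\<in>verts g. \<Sum>y\<in>verts g. mult g x y) \<le> total_volume g"
proof -
  have "of_nat (\<Sum>y\<in>verts g. mult g x y) \<le> degree g x" for x
  proof -
    have "of_nat (\<Sum>y\<in>verts g. mult g x y) = (\<integral>\<^sup>+y. of_nat (mult g x y) \<partial>count_space (verts g))"
      using assms by (simp add: nn_integral_count_space_finite)
    also have "\<dots> \<le> degree g x"
      unfolding degree_def by (subst nn_integral_count_space_indicator)
        (auto intro!: nn_integral_mono split: split_indicator)
    finally show ?thesis .
  qed
  then have "(\<Sum>x\<in>verts g. of_nat (\<Sum>y\<in>verts g. mult g x y)) \<le> (\<Sum>x\<in>verts g. degree g x)"
    by (intro sum_mono)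
  also have "\<dots> = total_volume g"
    unfolding total_volume_def degree_measure_def using assms by (subst emeasure_point_measure_finite) auto
  finally show ?thesis
    by simp
qed

lemma AE_finite_volume:
  fixes L :: "nat \<Rightarrow> nat dgraph measure"
  assumes law: "\<And>n. n \<ge> 1 \<Longrightarrow> inserted_graph_law n (L n)"
    and bound: "(\<lambda>t. SUP n\<in>{1..}. prob_graph (L n) (\<lambda>g. ennreal (t * real n powr v) \<le> total_volume g))
        \<in> O[at_top](\<lambda>t::real. t powr (- p))" and p: "p > 0" and n: "n \<ge> 1"
  shows "AE g in L n. total_volume g < \<infinity>"
proof -
  have L: "prob_space (L n)" "sets (L n) = sets dgraph_space" if "n \<ge> 1" for n
    using law[OF that] by (auto simp: inserted_graph_law_def)
  interpret prob_space "L n" using L n by blast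
  have meas: "total_volume \<in> borel_measurable (L n)"
    using measurable_total_volume n by (simp add: measurable_cong_sets[OF L(2)])
  let ?I = "{g \<in> space (L n). total_volume g = \<infinity>}"
  have I: "?I \<in> sets (L n)"
    using measurable_sets[OF meas, of "{\<infinity>}"] by (simp add: vimage_def Int_def conj_commute)
  have ge: "{g \<in> space (L n). b \<le> total_volume g} \<in> sets (L n)" for b
    using measurable_sets[OF meas, of "{b..}"] by (simp add: vimage_def Int_def conj_commute)
  let ?F = "\<lambda>t. SUP n\<in>{1..}. prob_graph (L n) (\<lambda>g. ennreal (t * real n powr v) \<le> total_volume g)"
  obtain C where C: "eventually (\<lambda>t. norm (?F t) \<le> C * norm (t powr (- p))) at_top"
    using bound by (elim landau_o.bigE)
  have "eventually (\<lambda>t. prob ?I \<le> C * t powr (- p)) at_top"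
    using C
  proof eventually_elim
    case (elim t)
    have "prob ?I
        \<le> prob_graph (L n) (\<lambda>g. ennreal (t * real n powr v) \<le> total_volume g)"
      unfolding prob_graph_def by (intro finite_measure_mono ge) auto
    also have "\<dots> \<le> ?F t"
    proof (rule cSUP_upper)
      show "bdd_above ((\<lambda>n. prob_graph (L n) (\<lambda>g. ennreal (t * real n powr v) \<le> total_volume g)) ` {1..})"
        using L(1) by (intro bdd_aboveI[where M = 1]) (auto simp: prob_graph_def prob_space.prob_le_1)
    qed (use n in auto)
    finally show ?case
      using elim by simp
  qed
  moreover have "((\<lambda>t. C * t powr (- p)) \<longlongrightarrow> C * 0) at_top"
    by (intro tendsto_intros tendsto_neg_powr filterlim_ident) (use p in auto)
  ultimately have "prob ?I \<le> C * 0"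
    by (intro tendsto_lowerbound[where F = at_top]) auto
  then have "prob ?I = 0"
    using measure_nonneg[of "L n" "?I"] by linarith
  then show ?thesis
    using I by (intro AE_I[where N = ?I]) (auto simp: emeasure_eq_measure less_top[symmetric])
qed

section \<open>Light graphs along the backbone\<close>

lemma AE_pair_fst:
  assumes "prob_space B" "AE x in A. P x"
  shows "AE z in A \<Otimes>\<^sub>M B. P (fst z)"
proof (rule AE_distrD[OF measurable_fst])
  show "AE x in distr (A \<Otimes>\<^sub>M B) A fst. P x"
    unfolding prob_space.distr_pair_fst[OF assms(1)] by (rule assms(2))
qed

lemma AE_pair_snd:
  assumes "prob_space A" "sigma_finite_measure B" "AE y in B. P y"
  shows "AE z in A \<Otimes>\<^sub>M B. P (snd z)"
proof -
  interpret A: prob_space A by fact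
  interpret B: sigma_finite_measure B by fact
  have "distr (A \<Otimes>\<^sub>M B) B snd = B"
  proof (rule measure_eqI)
    fix X assume "X \<in> sets (distr (A \<Otimes>\<^sub>M B) B snd)"
    then have X: "X \<in> sets B" by simp
    then have "snd -` X \<inter> space (A \<Otimes>\<^sub>M B) = space A \<times> X"
      using sets.sets_into_space[OF X] by (auto simp: space_pair_measure)
    then show "emeasure (distr (A \<Otimes>\<^sub>M B) B snd) X = emeasure B X"
      using X by (simp add: emeasure_distr B.emeasure_pair_measure_Times A.emeasure_space_1)
  qed simp
  with assms(3) have "AE y in distr (A \<Otimes>\<^sub>M B) B snd. P y"
    by (simp only:)
  then show ?thesis
    by (rule AE_distrD[OF measurable_snd])
qed

text \<open>
  A case of the second Borel-Cantelli lemma: the coordinates are independent, so \<open>n\<close> consecutive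
  failures have probability at most \<open>(1 - \<gamma>) ^ n\<close>.
\<close>

lemma AE_PiM_infinitely_often:
  fixes e :: "nat \<Rightarrow> 'i"
  assumes N: "\<And>i. i \<in> I \<Longrightarrow> prob_space (N i)"
    and e: "inj e" "range e \<subseteq> I"
    and B: "\<And>k. B k \<in> sets (N (e k))" "\<And>k. \<gamma> \<le> measure (N (e k)) (B k)" and \<gamma>: "0 < \<gamma>"
  shows "AE \<omega> in PiM I N. \<exists>\<^sub>\<infinity>k. \<omega> (e k) \<in> B k"
proof -
  interpret prob_space "PiM I N" by (intro prob_space_PiM N)
  have eI: "e k \<in> I" for k
    using e(2) by blast
  have "\<gamma> \<le> 1"
    using B(2)[of 0] prob_space.prob_le_1[OF N, of "e 0" "B 0"] e by force
  have "AE \<omega> in PiM I N. \<exists>k\<ge>m. \<omega> (e k) \<in> B k" for m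
  proof -
    define bad where "bad n = {\<omega> \<in> space (PiM I N). \<forall>k\<in>{m..<m+n}. \<omega> (e k) \<notin> B k}" for n
    have bad: "bad n \<in> sets (PiM I N)" "prob (bad n) \<le> (1 - \<gamma>) ^ n" for n
    proof -
      let ?J = "e ` {m..<m+n}"
      let ?A = "\<lambda>i. space (N i) - B (inv e i)"
      have A: "?A i \<in> sets (N i)" if i: "i \<in> ?J" for i
      proof -
        obtain k where "i = e k"
          using i by blast
        then show ?thesis
          using B(1)[of k] e(1) by (simp add: inv_f_f sets.compl_sets)
      qed
      have eq: "bad n = prod_emb I N ?J (PiE ?J ?A)"
        using e(1) eI by (auto simp: bad_def prod_emb_def space_PiM inv_f_f PiE_iff extensional_def)
      have *: "emeasure (PiM I N) (bad n) = (\<Prod>i\<in>?J. emeasure (N i) (?A i))"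
        unfolding eq using e by (intro emeasure_PiM_emb N A) auto
      show "bad n \<in> sets (PiM I N)"
        unfolding eq using e by (intro sets_PiM_I ballI A) auto
      have "emeasure (PiM I N) (bad n) = (\<Prod>k\<in>{m..<m+n}. emeasure (N (e k)) (space (N (e k)) - B k))"
        unfolding * using e by (subst prod.reindex) (auto simp: inv_f_f inj_on_def)
      also have "\<dots> \<le> (\<Prod>k\<in>{m..<m+n}. ennreal (1 - \<gamma>))"
      proof (intro prod_mono_ennreal)
        fix k
        interpret K: prob_space "N (e k)" using N e by blast
        show "emeasure (N (e k)) (space (N (e k)) - B k) \<le> ennreal (1 - \<gamma>)"
          using B(2)[of k] K.prob_compl[OF B(1)] by (simp add: K.emeasure_eq_measure ennreal_leI)
      qed
      also have "\<dots> = ennreal ((1 - \<gamma>) ^ n)"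
        using \<open>\<gamma> \<le> 1\<close> by (simp add: ennreal_power)
      finally show "prob (bad n) \<le> (1 - \<gamma>) ^ n"
        using \<open>\<gamma> \<le> 1\<close> by (simp add: emeasure_eq_measure)
    qed
    have "prob (\<Inter>n. bad n) \<le> (1 - \<gamma>) ^ n" for n
      using bad by (intro order_trans[OF finite_measure_mono bad(2)]) auto
    moreover have "(\<lambda>n. (1 - \<gamma>) ^ n) \<longlonglongrightarrow> 0"
      using \<gamma> \<open>\<gamma> \<le> 1\<close> by (intro LIMSEQ_realpow_zero) auto
    ultimately have "prob (\<Inter>n. bad n) \<le> 0"
      using LIMSEQ_le_const by fastforce
    then have "prob (\<Inter>n. bad n) = 0"
      using measure_nonneg[of "PiM I N" "\<Inter>n. bad n"] by linarith
    then show ?thesis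
      using bad(1) by (intro AE_I[where N = "\<Inter>n. bad n"]) (auto simp: emeasure_eq_measure bad_def)
  qed
  then show ?thesis
    unfolding INFM_nat_le by (simp add: AE_all_countable)
qed

lemma sets_spine: "{\<tau>. spine \<tau> i = u} \<in> sets (kesten \<xi>)"
proof (induction i arbitrary: u)
  case 0
  then show ?case using sets.top[of "kesten \<xi>"] by (cases "u = []") auto
next
  case (Suc i)
  have "{\<tau>. spine \<tau> (Suc i) = u} = (\<Union>w. {\<tau>. spine \<tau> i = w} \<inter> {\<tau>. w @ [snd (snd (\<tau> w))] = u})"
    by auto
  also have "\<dots> \<in> sets (kesten \<xi>)"
    using Suc sets_kesten_coordinate[of "\<lambda>t. _ @ [snd (snd t)] = u"] by (intro sets.countable_UN') auto
  finally show ?case .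
qed

lemma prob_space_decoration:
  assumes "\<And>n. n \<ge> 1 \<Longrightarrow> prob_space (L n)" "i \<in> UNIV \<times> {1..}"
  shows "prob_space (case i of (u, n) \<Rightarrow> L n \<Otimes>\<^sub>M measure_pmf (pmf_of_set {0..<n}))"
  using assms by (auto intro!: prob_space_pair measure_pmf.prob_space_axioms)

lemma AE_decoration_law:
  assumes L: "\<And>n. n \<ge> 1 \<Longrightarrow> prob_space (L n)" and P: "\<And>n. n \<ge> 1 \<Longrightarrow> AE g in L n. P n g"
  shows "AE \<delta> in decoration_law L. \<forall>u n. n \<ge> 1 \<longrightarrow> P n (fst (\<delta> (u, n)))"
proof -
  have "AE \<delta> in decoration_law L. P n (fst (\<delta> (u, n)))" if n: "n \<ge> 1" for u n
  proof -
    have "AE x in L n \<Otimes>\<^sub>M measure_pmf (pmf_of_set {0..<n}). P n (fst x)"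
      by (intro AE_pair_fst measure_pmf.prob_space_axioms P n)
    then show ?thesis
      unfolding decoration_law_def using n
      by (intro AE_PiM_component[where P = "\<lambda>x. P n (fst x)"] prob_space_decoration L) auto
  qed
  then show ?thesis
    by (simp add: AE_all_countable)
qed

text \<open>
  Given the tree, the graphs at the backbone vertices with \<open>b\<close> children are independent copies with
  law \<open>L (b + 1)\<close>, so infinitely many of them have volume at most \<open>M\<close>. Fubini's theorem requires the measurability
  of the joint event, which is a countable union over the possible positions \<open>u\<close> of \<open>s\<^sub>i\<close>.
\<close>

lemma AE_light_graphs_on_spine:
  assumes L: "\<And>n. n \<ge> 1 \<Longrightarrow> prob_space (L n)" "\<And>n. n \<ge> 1 \<Longrightarrow> sets (L n) = sets dgraph_space"
    and b: "pmf (size_biased \<xi>) b > 0"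
    and M: "measure (L (b + 1)) {g \<in> space (L (b + 1)). total_volume g \<le> M} > 0"
  shows "AE z in decorated_tree_law \<xi> L. \<exists>\<^sub>\<infinity>i. fst (snd (fst z (spine (fst z) i))) = b \<and>
           total_volume (fst (snd z (spine (fst z) i, b + 1))) \<le> M"
    (is "AE z in _. ?Q z")
proof -
  let ?n = "b + 1"
  let ?N = "\<lambda>(u, n). L n \<Otimes>\<^sub>M measure_pmf (pmf_of_set {0..<n})"
  let ?I = "UNIV \<times> {1..} :: (nat list \<times> nat) set"
  let ?light = "{g \<in> space (L ?n). total_volume g \<le> M}"
  interpret K: prob_space "kesten \<xi>" by (rule prob_space_kesten)
  interpret D: prob_space "decoration_law L"
    unfolding decoration_law_def by (intro prob_space_PiM prob_space_decoration L)
  interpret KD: pair_prob_space "kesten \<xi>" "decoration_law L" ..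
  have "total_volume \<in> borel_measurable (L ?n)"
    using measurable_total_volume L(2)[of ?n] by (simp add: measurable_cong_sets[OF L(2)])
  then have light: "?light \<in> sets (L ?n)"
    using measurable_sets[of total_volume "L ?n" borel "{..M}"] by (simp add: vimage_def Int_def conj_commute)
  have fst_coord: "(\<lambda>\<delta>. fst (\<delta> (u, ?n))) \<in> decoration_law L \<rightarrow>\<^sub>M L ?n" for u
    unfolding decoration_law_def
    by (intro measurable_compose[OF measurable_component_singleton[of "(u, ?n)" ?I ?N] ]) auto
  have coord: "{\<delta> \<in> space (decoration_law L). total_volume (fst (\<delta> (u, ?n))) \<le> M} \<in> sets (decoration_law L)" for u
    using measurable_sets[OF fst_coord light, of u] measurable_space[OF fst_coord, of _ u]
    by (simp add: vimage_def Int_def conj_commute) (metis (mono_tags, lifting) Collect_cong)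
  have "AE z in kesten \<xi> \<Otimes>\<^sub>M decoration_law L. ?Q z"
  proof (rule KD.AE_pair_measure)
    let ?S = "space (kesten \<xi> \<Otimes>\<^sub>M decoration_law L)"
    let ?R = "\<lambda>u z. fst (snd (fst z u)) = b \<and> total_volume (fst (snd z (u, ?n))) \<le> M"
    have "{z \<in> ?S. ?R (spine (fst z) i) z} \<in> sets (kesten \<xi> \<Otimes>\<^sub>M decoration_law L)" for i
    proof -
      have "{z \<in> ?S. ?R (spine (fst z) i) z} =
          (\<Union>u. ({\<tau>. spine \<tau> i = u} \<inter> {\<tau>. fst (snd (\<tau> u)) = b}) \<times>
             {\<delta> \<in> space (decoration_law L). total_volume (fst (\<delta> (u, ?n))) \<le> M})"
        by (auto simp: space_pair_measure)
      also have "\<dots> \<in> sets (kesten \<xi> \<Otimes>\<^sub>M decoration_law L)"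
        using sets_spine sets_kesten_coordinate[of "\<lambda>t. fst (snd t) = b"] coord
        by (intro sets.countable_UN' pair_measureI sets.Int) auto
      finally show ?thesis .
    qed
    then have "(\<Inter>m. \<Union>i\<in>{m..}. {z \<in> ?S. ?R (spine (fst z) i) z}) \<in> sets (kesten \<xi> \<Otimes>\<^sub>M decoration_law L)"
      by (intro sets.countable_INT' sets.countable_UN') auto
    also have "(\<Inter>m. \<Union>i\<in>{m..}. {z \<in> ?S. ?R (spine (fst z) i) z}) = {z \<in> ?S. ?Q z}"
      by (auto simp: INFM_nat_le)
    finally show "{z \<in> ?S. ?Q z} \<in> sets (kesten \<xi> \<Otimes>\<^sub>M decoration_law L)" .
  next
    show "AE \<tau> in kesten \<xi>. AE \<delta> in decoration_law L. ?Q (\<tau>, \<delta>)"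
      using AE_kesten_spine_infinitely_often[OF b]
    proof eventually_elim
      fix \<tau> assume "\<exists>\<^sub>\<infinity>i. fst (snd (\<tau> (spine \<tau> i))) = b"
      then have "infinite {i. fst (snd (\<tau> (spine \<tau> i))) = b}"
        by (simp add: frequently_cofinite)
      then obtain r :: "nat \<Rightarrow> nat" where r: "strict_mono r" "\<forall>k. r k \<in> {i. fst (snd (\<tau> (spine \<tau> i))) = b}"
        using infinite_enumerate by blast
      define e where "e k = (spine \<tau> (r k), ?n)" for k
      have inj: "inj e"
      proof (rule injI)
        fix k l assume "e k = e l"
        then have "length (spine \<tau> (r k)) = length (spine \<tau> (r l))"
          by (simp add: e_def)
        then show "k = l"
          using strict_mono_eq[OF r(1)] by simp
      qed
      have range: "range e \<subseteq> ?I"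
        by (auto simp: e_def)
      have sets: "?light \<times> UNIV \<in> sets (?N (e k))" for k
        using light by (simp add: e_def)
      have le: "measure (L ?n) ?light \<le> measure (?N (e k)) (?light \<times> UNIV)" for k
      proof -
        have "emeasure (L ?n \<Otimes>\<^sub>M measure_pmf (pmf_of_set {0..<?n})) (?light \<times> UNIV) = emeasure (L ?n) ?light"
          using light by (subst measure_pmf.emeasure_pair_measure_Times) (auto simp: measure_pmf.emeasure_space_1[simplified])
        then show ?thesis
          by (simp add: e_def measure_def)
      qed
      have "AE \<delta> in PiM ?I ?N. \<exists>\<^sub>\<infinity>k. \<delta> (e k) \<in> ?light \<times> UNIV"
      proof (rule AE_PiM_infinitely_often[where I = ?I and N = ?N and e = e and B = "\<lambda>_. ?light \<times> UNIV",
            OF _ inj range sets le M])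
        show "prob_space (?N i)" if "i \<in> ?I" for i
          by (rule prob_space_decoration[OF _ that]) (rule L(1))
      qed
      then show "AE \<delta> in decoration_law L. ?Q (\<tau>, \<delta>)"
        unfolding decoration_law_def[symmetric]
      proof eventually_elim
        fix \<delta> :: decorations assume *: "\<exists>\<^sub>\<infinity>k. \<delta> (e k) \<in> ?light \<times> UNIV"
        show "?Q (\<tau>, \<delta>)"
          unfolding INFM_nat_le
        proof (intro allI)
          fix m
          have "\<exists>k\<ge>m. \<delta> (e k) \<in> ?light \<times> UNIV"
            using * unfolding INFM_nat_le by (rule spec)
          then obtain k where k: "k \<ge> m" "\<delta> (e k) \<in> ?light \<times> UNIV"
            by (elim exE conjE)
          have "m \<le> r k"
            using k(1) seq_suble[OF r(1), of k] by simp
          then show "\<exists>i\<ge>m. fst (snd (fst (\<tau>, \<delta>) (spine (fst (\<tau>, \<delta>)) i))) = b \<and>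
              total_volume (fst (snd (\<tau>, \<delta>) (spine (fst (\<tau>, \<delta>)) i, ?n))) \<le> M"
            using k(2) r(2) by (intro exI[of _ "r k"]) (auto simp: e_def)
        qed
      qed
    qed
  qed
  then show ?thesis
    unfolding decorated_tree_law_def .
qed

section \<open>Recurrence of the decorated tree\<close>

lemma exists_offspring_ge_2:
  fixes \<alpha> c :: real and \<xi> :: "nat pmf"
  assumes "0 < c" "(\<lambda>k. pmf \<xi> k) \<sim>[at_top] (\<lambda>k. c * real k powr (- \<alpha> - 1))"
  shows "\<exists>k\<in>set_pmf \<xi>. 2 \<le> k"
proof -
  have ev: "eventually (\<lambda>k::nat. 2 \<le> k \<and> (pmf \<xi> k > 0 \<longleftrightarrow> c * real k powr (- \<alpha> - 1) > 0)) at_top"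
    by (intro eventually_conj eventually_ge_at_top asymp_equiv_eventually_pos_iff[OF assms(2)])
  obtain k :: nat where "2 \<le> k \<and> (pmf \<xi> k > 0 \<longleftrightarrow> c * real k powr (- \<alpha> - 1) > 0)"
    using eventually_happens'[OF sequentially_bot ev] by blast
  then show ?thesis
    using assms(1) by (intro bexI[of _ k]) (auto simp: set_pmf_iff)
qed

theorem theorem1p4:
  fixes \<alpha> c d R v \<epsilon> :: real
    and \<xi> :: "nat pmf"
    and L :: "nat \<Rightarrow> nat dgraph measure"
  assumes alpha: "1 < \<alpha>" "\<alpha> < 2"
    and critical: "integrable (measure_pmf \<xi>) real" "measure_pmf.expectation \<xi> real = 1"
    and tail: "0 < c" "(\<lambda>k. pmf \<xi> k) \<sim>[at_top] (\<lambda>k. c * real k powr (- \<alpha> - 1))"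
    and law: "\<And>n. n \<ge> 1 \<Longrightarrow> inserted_graph_law n (L n)"
    and exponents: "1 \<le> d" "1 \<le> R" "1 \<le> v" "0 < \<epsilon>"
    and D_lower: "0 < (INF n\<in>{2..}. prob_pair (L n) (\<lambda>g x y. real n powr (1 / d) \<le> gdist g x y))"
    and D_upper: "(\<lambda>t. SUP n\<in>{1..}. prob_graph (L n) (\<lambda>g. ennreal (t * real n powr (1 / d)) \<le> graph_diameter g))
                    \<in> O[at_top](\<lambda>t::real. t powr (- ((\<alpha> + \<epsilon>) / (\<alpha> - 1))))"
    and R_lower: "0 < (INF n\<in>{2..}. prob_pair (L n) (\<lambda>g x y. ennreal (real n powr (1 / R)) \<le> eff_resistance g x y))"
    and R_upper: "(\<lambda>t. SUP n\<in>{1..}. prob_graph (L n) (\<lambda>g. ennreal (t * real n powr (1 / R)) \<le> res_diameter g))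
                    \<in> O[at_top](\<lambda>t::real. t powr (- ((\<alpha> + \<epsilon>) / (\<alpha> - 1))))"
    and V_lower: "0 < (INF n\<in>{1..}. prob_graph (L n) (\<lambda>g. ennreal (real n powr v) \<le> total_volume g))"
    and V_upper: "(\<lambda>t. SUP n\<in>{1..}. prob_graph (L n) (\<lambda>g. ennreal (t * real n powr v) \<le> total_volume g))
                    \<in> O[at_top](\<lambda>t::real. t powr (- ((\<alpha> + \<epsilon>) / v)))"
  shows "AE (\<tau>, \<delta>) in decorated_tree_law \<xi> L. recurrent (decorated_tree \<tau> \<delta>) dec_root"
proof -
  have L: "prob_space (L n)" "sets (L n) = sets dgraph_space" "AE g in L n. is_inserted_graph n g" if "n \<ge> 1" for n
    using law[OF that] by (auto simp: inserted_graph_law_def)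
  have finite_volume: "AE g in L n. total_volume g < \<infinity>" if "n \<ge> 1" for n
    by (rule AE_finite_volume[OF law V_upper _ that]) (use alpha exponents in auto)
  obtain b where b: "b \<in> set_pmf \<xi>" "2 \<le> b"
    using exists_offspring_ge_2[OF tail] by blast
  have b_pos: "pmf (size_biased \<xi>) b > 0"
    using b by (simp add: pmf_size_biased[OF critical] set_pmf_iff pmf_pos)

  interpret Lb: prob_space "L (b + 1)"
    by (rule L) simp
  \<comment> \<open>A finite volume is at most \<open>M\<close> with positive probability if \<open>M\<close> is large.\<close>
  obtain M :: nat where M: "Lb.prob {g \<in> space (L (b + 1)). total_volume g \<le> of_nat M} > 0"
  proof (rule ccontr)
    assume no: "\<not> thesis"
    have "AE g in L (b + 1). \<not> total_volume g \<le> of_nat M" for M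
    proof -
      have meas: "{g \<in> space (L (b + 1)). total_volume g \<le> of_nat M} \<in> sets (L (b + 1))"
        using measurable_sets[of total_volume "L (b + 1)" borel "{..of_nat M}"] measurable_total_volume
        by (simp add: measurable_cong_sets[OF L(2) refl] vimage_def Int_def conj_commute)
      have "\<not> Lb.prob {g \<in> space (L (b + 1)). total_volume g \<le> of_nat M} > 0"
        using no that[of M] by blast
      then have "emeasure (L (b + 1)) {g \<in> space (L (b + 1)). total_volume g \<le> of_nat M} = 0"
        by (simp only: Lb.emeasure_eq_measure zero_less_measure_iff not_not ennreal_0)
      then show ?thesis
        using meas by (intro AE_I[where N = "{g \<in> space (L (b + 1)). total_volume g \<le> of_nat M}"]) auto
    qed
    then have "AE g in L (b + 1). \<forall>M. \<not> total_volume g \<le> of_nat M"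
      by (simp add: AE_all_countable)
    moreover have "AE g in L (b + 1). total_volume g < \<infinity>"
      by (rule finite_volume) simp
    ultimately have "AE g in L (b + 1). False"
    proof eventually_elim
      case (elim g)
      then show False
        using ennreal_Ex_less_of_nat[of "total_volume g"] by (auto dest: less_imp_le)
    qed
    then show False
      using Lb.AE_False by simp
  qed

  have graphs: "AE z in decorated_tree_law \<xi> L. \<forall>u n. n \<ge> 1 \<longrightarrow>
      is_inserted_graph n (fst (snd z (u, n))) \<and> total_volume (fst (snd z (u, n))) < \<infinity>"
    unfolding decorated_tree_law_def
  proof (rule AE_pair_snd[OF prob_space_kesten])
    show "sigma_finite_measure (decoration_law L)"
      unfolding decoration_law_def
      by (intro prob_space_imp_sigma_finite prob_space_PiM prob_space_decoration L)
    show "AE \<delta> in decoration_law L. \<forall>u n. n \<ge> 1 \<longrightarrow>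
        is_inserted_graph n (fst (\<delta> (u, n))) \<and> total_volume (fst (\<delta> (u, n))) < \<infinity>"
      by (rule AE_decoration_law) (use L finite_volume in auto)
  qed
  have bushes: "AE z in decorated_tree_law \<xi> L. \<forall>u. \<exists>n. \<not> reaches (fst z) n u"
    unfolding decorated_tree_law_def
  proof (rule AE_pair_fst)
    show "prob_space (decoration_law L)"
      unfolding decoration_law_def by (intro prob_space_PiM prob_space_decoration L)
  qed (rule AE_kesten_extinction[OF critical b])
  have light: "AE z in decorated_tree_law \<xi> L. \<exists>\<^sub>\<infinity>i. fst (snd (fst z (spine (fst z) i))) = b \<and>
      total_volume (fst (snd z (spine (fst z) i, b + 1))) \<le> of_nat M"
    by (rule AE_light_graphs_on_spine[where L = L, OF _ _ b_pos M]) (fact L(1), fact L(2))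

  have "AE z in decorated_tree_law \<xi> L. recurrent (decorated_tree (fst z) (snd z)) dec_root"
    using graphs bushes light
  proof eventually_elim
    case (elim z)
    obtain \<tau> \<delta> where z: "z = (\<tau>, \<delta>)" by (cases z)
    let ?g = "inserted \<tau> \<delta>"
    have g: "is_inserted_graph (tree_degree \<tau> u) (?g u)" "total_volume (?g u) < \<infinity>" for u
      using elim(1)[rule_format, of "tree_degree \<tau> u" u] by (simp_all add: z inserted_def tree_degree_def)
    have fin: "finite (verts (?g u))" for u
      using finite_graph_if_finite_volume g by blast
    have "\<exists>\<^sub>\<infinity>i. (\<Sum>x\<in>verts (?g (spine \<tau> i)). \<Sum>y\<in>verts (?g (spine \<tau> i)). mult (?g (spine \<tau> i)) x y) \<le> M"
      using elim(3)
    proof (rule frequently_elim1)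
      fix i
      assume i: "fst (snd (fst z (spine (fst z) i))) = b \<and>
        total_volume (fst (snd z (spine (fst z) i, b + 1))) \<le> of_nat M"
      have "tree_degree \<tau> (spine \<tau> i) = b + 1"
        using i by (simp add: z tree_degree_def num_children_special[OF spine_special])
      then have "total_volume (?g (spine \<tau> i)) \<le> of_nat M"
        using i by (simp add: z inserted_def)
      then have "(of_nat (\<Sum>x\<in>verts (?g (spine \<tau> i)). \<Sum>y\<in>verts (?g (spine \<tau> i)). mult (?g (spine \<tau> i)) x y) :: ennreal) \<le> of_nat M"
        using sum_mult_le_total_volume[OF fin] order_trans by blast
      then show "(\<Sum>x\<in>verts (?g (spine \<tau> i)). \<Sum>y\<in>verts (?g (spine \<tau> i)). mult (?g (spine \<tau> i)) x y) \<le> M"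
        by (simp only: of_nat_le_iff)
    qed
    then show ?case
      using g fin elim(2) unfolding z fst_conv snd_conv
      by (intro recurrent_decorated_tree) (auto simp: is_inserted_graph_def)
  qed
  then show ?thesis
    by (simp add: case_prod_beta)
qed

end
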